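(* Let $\Phi:PH\to 2^{QH}$ be defined by $\Phi(p_0)=\{q_0\in QH:(p_0,q_0)\in\mathcal M_{-\infty}\}$. If $\Phi$ is single valued, i.e. $\Phi(p_0)$ consists of exactly one point for every $p_0\in PH$, then $\mathcal M_\infty=\mathcal M_{-\infty}$.
   Context: Standing assumptions: $H$ is a real Hilbert space with norm $|\cdot|$. $A$ is a linear, closed, unbounded, positive self-adjoint operator on $H$ with compact inverse, so $H$ has an orthonormal basis of eigenvectors of $A$ with eigenvalues $0<\lambda_1<\lambda_2\le\cdots\le\lambda_N<\lambda_{N+1}\le\cdots\to\infty$ (counted with multiplicity). $F:H\to H$ satisfies $|F(u)|\le K_0$ and $|F(u)-F(v)|\le K_1|u-v|$ for all $u,v\in H$, with constants $K_0,K_1>0$ and $K_1<\lambda_{N+1}$; moreover there is $R>0$ with $F(u)=0$ whenever $|u|\ge R$. $P$ is the orthogonal (spectral) projection onto the span of the first $N$ eigenvectors of $A$, and $Q=I-P$; points of $H$ are identified with pairs $(p,q)\in PH\times QH$. A solution on an interval $J$ means a continuous function satisfying the variation of constants formula $u(t)=e^{-A(t-s)}u(s)+\int_s^t e^{-A(t-\tau)}F(u(\tau))\,d\tau$ for all $s\le t$ in $J$. For $t>0$, $\mathcal M_t=\{u(t): u \text{ is a solution of } u_t+Au=F(u) \text{ on } [0,t] \text{ with } Pu(0)\in PH \text{ arbitrary and } Qu(0)=0\}$. $\mathcal M_\infty$ is the set of all $(p_\infty,q_\infty)\in H$ for which there exist integers $n_1<n_2<\cdots$ and points $(p_{n_k},q_{n_k})\in\mathcal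 M_{n_k}$ with $(p_{n_k},q_{n_k})\to(p_\infty,q_\infty)$ in $H$. $\mathcal M_{-\infty}$ is the set of all $(p_0,q_0)\in H$ such that there is a solution $u(t)=p(t)+q(t)$ of $u_t+Au=F(u)$ on $(-\infty,0]$ with $p(0)=p_0$, $q(0)=q_0$ and $q(t)=Qu(t)$ bounded on $(-\infty,0]$. *)

theory Defs
  imports "HOL-Analysis.Analysis"
begin

text \<open>The operator A is represented spectrally by an orthonormal basis e of
eigenvectors (e k has eigenvalue lam k; index k here corresponds to index k+1
in the paper). Everything about A enters only via the semigroup e^{-At} and
the spectral projection P.\<close>

definition projP :: "nat \<Rightarrow> (nat \<Rightarrow> 'a::real_inner) \<Rightarrow> 'a \<Rightarrow> 'a" where
  "projP N e u = (\<Sum>k<N. (u \<bullet> e k) *\<^sub>R e k)"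

definition projQ :: "nat \<Rightarrow> (nat \<Rightarrow> 'a::real_inner) \<Rightarrow> 'a \<Rightarrow> 'a" where
  "projQ N e u = u - projP N e u"

definition semigrp :: "(nat \<Rightarrow> real) \<Rightarrow> (nat \<Rightarrow> 'a::real_inner) \<Rightarrow> real \<Rightarrow> 'a \<Rightarrow> 'a" where
  "semigrp lam e t u = (\<Sum>k. (exp (- (lam k * t)) * (u \<bullet> e k)) *\<^sub>R e k)"

text \<open>Mild solution of u_t + Au = F(u) on an interval J (variation of constants).\<close>
definition mild_solution ::
  "(nat \<Rightarrow> real) \<Rightarrow> (nat \<Rightarrow> 'a::{real_inner,complete_space}) \<Rightarrow> ('a \<Rightarrow> 'a) \<Rightarrow> real set \<Rightarrow> (real \<Rightarrow> 'a) \<Rightarrow> bool" where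
  "mild_solution lam e F J u \<longleftrightarrow> continuous_on J u \<and>
     (\<forall>s\<in>J. \<forall>t\<in>J. s \<le> t \<longrightarrow>
        ((\<lambda>\<tau>. semigrp lam e (t - \<tau>) (F (u \<tau>))) has_integral
           (u t - semigrp lam e (t - s) (u s))) {s..t})"

definition Mt ::
  "(nat \<Rightarrow> real) \<Rightarrow> (nat \<Rightarrow> 'a::{real_inner,complete_space}) \<Rightarrow> ('a \<Rightarrow> 'a) \<Rightarrow> nat \<Rightarrow> real \<Rightarrow> 'a set" where
  "Mt lam e F N t = {u t | u. mild_solution lam e F {0..t} u \<and> projQ N e (u 0) = 0}"

definition M_pinf ::
  "(nat \<Rightarrow> real) \<Rightarrow> (nat \<Rightarrow> 'a::{real_inner,complete_space}) \<Rightarrow> ('a \<Rightarrow> 'a) \<Rightarrow> nat \<Rightarrow> 'a set" where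
  "M_pinf lam e F N = {x. \<exists>n::nat \<Rightarrow> nat. \<exists>y::nat \<Rightarrow> 'a. strict_mono n \<and> (\<forall>k. 0 < n k) \<and>
      (\<forall>k. y k \<in> Mt lam e F N (real (n k))) \<and> y \<longlonglongrightarrow> x}"

definition M_ninf ::
  "(nat \<Rightarrow> real) \<Rightarrow> (nat \<Rightarrow> 'a::{real_inner,complete_space}) \<Rightarrow> ('a \<Rightarrow> 'a) \<Rightarrow> nat \<Rightarrow> 'a set" where
  "M_ninf lam e F N = {x. \<exists>u. mild_solution lam e F {..0} u \<and> u 0 = x \<and>
      bounded ((\<lambda>t. projQ N e (u t)) ` {..0})}"

definition Phi ::
  "(nat \<Rightarrow> real) \<Rightarrow> (nat \<Rightarrow> 'a::{real_inner,complete_space}) \<Rightarrow> ('a \<Rightarrow> 'a) \<Rightarrow> nat \<Rightarrow> 'a \<Rightarrow> 'a set" where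
  "Phi lam e F N p0 = {q0 \<in> range (projQ N e). p0 + q0 \<in> M_ninf lam e F N}"

end

theory Submission
  imports Defs "HOL-Library.Diagonal_Subsequence"
begin

text \<open>
  If \<open>Q u\<close> vanishes initially, then the components of \<open>u\<close> beyond the \<open>M\<close>-th mode stay below \<open>K0 / lam M\<close>,
  which tends to zero; since backwards in time the individual coefficients grow at most exponentially, the
  solutions defining \<open>M_pinf\<close>, shifted to end at time \<open>0\<close>, lie in a compact set at each negative
  integer time. A diagonal subsequence converges there, hence locally uniformly by Gronwall, and the
  limit is a solution on the half line; thus \<open>M_pinf \<subseteq> M_ninf\<close>.

  Conversely, a topological argument (Poincare--Miranda) yields for every \<open>n\<close> a solution on
  \<open>[0, n]\<close> starting in \<open>PH\<close> whose end point projects to a given \<open>p\<close>. Its end points accumulate at a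
  point of \<open>M_pinf \<subseteq> M_ninf\<close> over \<open>p\<close>, and by single-valuedness this is the only point of \<open>M_ninf\<close>
  over \<open>p\<close>.
\<close>

section \<open>Integration and Gronwall's inequality\<close>

text \<open>The library proves this for the class \<open>banach\<close>, of which the sort
  \<open>{real_inner, complete_space}\<close> is not formally an instance. The Cauchy criterion for integrability is
  transferred from the dual space, which is an instance, along the isometric embedding into it.\<close>
lemma continuous_imp_integrable_on_interval:
  fixes f :: "real \<Rightarrow> 'a::{real_inner,complete_space}"
  assumes "continuous_on {a..b} f"
  shows "f integrable_on {a..b}"
proof -
  let ?\<iota> = "blinfun_inner_left :: 'a \<Rightarrow> 'a \<Rightarrow>\<^sub>L real"
  interpret bl: bounded_linear ?\<iota>
    by (rule bounded_linear_blinfun_inner_left)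
  have norm_\<iota>: "norm (?\<iota> x) = norm x" for x
  proof (rule antisym)
    show "norm (?\<iota> x) \<le> norm x"
      by (rule norm_blinfun_bound) (auto simp: Cauchy_Schwarz_ineq2 mult.commute)
    have "norm x * norm x = blinfun_apply (?\<iota> x) x"
      by (simp add: power2_norm_eq_inner flip: power2_eq_square)
    also have "\<dots> \<le> norm (?\<iota> x) * norm x"
      using norm_blinfun[of "?\<iota> x" x] by simp
    finally show "norm x \<le> norm (?\<iota> x)"
      by (cases "x = 0") auto
  qed
  have "(\<lambda>x. ?\<iota> (f x)) integrable_on cbox a b"
    using assms by (intro integrable_continuous bl.continuous_on) auto
  moreover have "norm ((\<Sum>(x,K)\<in>D1. measure lborel K *\<^sub>R ?\<iota> (f x)) - (\<Sum>(x,K)\<in>D2. measure lborel K *\<^sub>R ?\<iota> (f x)))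
      = norm ((\<Sum>(x,K)\<in>D1. measure lborel K *\<^sub>R f x) - (\<Sum>(x,K)\<in>D2. measure lborel K *\<^sub>R f x))" for D1 D2 :: "(real \<times> real set) set"
  proof -
    have "(\<Sum>(x,K)\<in>D. measure lborel K *\<^sub>R ?\<iota> (f x)) = ?\<iota> (\<Sum>(x,K)\<in>D. measure lborel K *\<^sub>R f x)" for D :: "(real \<times> real set) set"
      by (simp add: bl.sum bl.scaleR split_def)
    then show ?thesis
      by (simp add: norm_\<iota> flip: bl.diff)
  qed
  ultimately have "f integrable_on cbox a b"
    unfolding integrable_Cauchy by simp
  then show ?thesis by simp
qed

text \<open>Pairing with the vector \<open>I\<close> itself reduces the claim to monotonicity of
  real integrals; afterwards one factor \<open>norm I\<close> cancels.\<close>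

lemma has_integral_norm_bound:
  fixes f :: "real \<Rightarrow> 'a::real_inner"
  assumes f: "(f has_integral I) {a..b}" and g: "(g has_integral J) {a..b}"
    and le: "\<And>x. x \<in> {a..b} \<Longrightarrow> norm (f x) \<le> g x"
  shows "norm I \<le> J"
proof -
  have "((\<lambda>x. f x \<bullet> I) has_integral I \<bullet> I) {a..b}"
    using has_integral_linear[OF f bounded_linear_inner_left] by (simp add: o_def)
  moreover have "((\<lambda>x. g x * norm I) has_integral J * norm I) {a..b}"
    using g by (rule has_integral_mult_left)
  ultimately have "I \<bullet> I \<le> J * norm I"
  proof (rule has_integral_le)
    fix x assume "x \<in> {a..b}"
    then show "f x \<bullet> I \<le> g x * norm I"
      using le norm_cauchy_schwarz[of "f x" I] by (meson mult_right_mono norm_ge_zero order_trans)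
  qed
  then have "norm I * norm I \<le> J * norm I"
    by (metis power2_eq_square power2_norm_eq_inner)
  moreover have "0 \<le> J"
    using has_integral_nonneg[OF g] le norm_ge_zero order_trans by blast
  ultimately show ?thesis
    by (cases "norm I = 0") (simp, metis mult_right_le_imp_le norm_ge_zero order_le_less)
qed

text \<open>The integral bound, damped by \<open>exp (- (K * (s - a)))\<close>, has nonpositive
  derivative and therefore stays below its initial value \<open>C\<close>.\<close>

lemma gronwall_integral:
  fixes f :: "real \<Rightarrow> real"
  assumes f: "continuous_on {a..b} f" and K: "0 \<le> K"
    and le: "\<And>t. t \<in> {a..b} \<Longrightarrow> f t \<le> C + K * integral {a..t} f"
    and t: "t \<in> {a..b}"
  shows "f t \<le> C * exp (K * (t - a))"
proof -
  define h where "h s = (C + K * integral {a..s} f) * exp (- (K * (s - a)))" for s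
  have cont: "continuous_on {a..t} (\<lambda>s. integral {a..s} f)"
    using f t by (intro indefinite_integral_continuous_1 integrable_continuous_real) (auto intro: continuous_on_subset)
  have "h t \<le> h a"
  proof (rule DERIV_nonpos_imp_decreasing_open[where f = h])
    show "a \<le> t" using t by simp
    show "continuous_on {a..t} h"
      unfolding h_def by (intro continuous_intros cont)
    fix s assume s: "a < s" "s < t"
    then have "((\<lambda>x. integral {a..x} f) has_real_derivative f s) (at s within {a..b})"
      using t by (intro integral_has_real_derivative f) auto
    then have D: "((\<lambda>x. integral {a..x} f) has_real_derivative f s) (at s)"
      using s t by (simp add: at_within_Icc_at)
    have "(h has_real_derivative
        (K * f s * exp (- (K * (s - a))) + (C + K * integral {a..s} f) * (exp (- (K * (s - a))) * (- K)))) (at s)"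
      unfolding h_def by (auto intro!: derivative_eq_intros D)
    moreover have "K * f s * exp (- (K * (s - a))) + (C + K * integral {a..s} f) * (exp (- (K * (s - a))) * (- K))
        = K * exp (- (K * (s - a))) * (f s - (C + K * integral {a..s} f))"
      by (simp add: algebra_simps)
    moreover have "\<dots> \<le> 0"
      using le[of s] s t K by (intro mult_nonneg_nonpos) auto
    ultimately show "\<exists>y. (h has_real_derivative y) (at s) \<and> y \<le> 0"
      by metis
  qed
  then have "C + K * integral {a..t} f \<le> C * exp (K * (t - a))"
    by (simp add: h_def exp_minus pos_divide_le_eq flip: divide_inverse)
  then show ?thesis using le[OF t] by linarith
qed

lemma has_integral_exp:
  fixes c :: real
  assumes "c \<noteq> 0" and "a \<le> b"
  shows "((\<lambda>x. exp (c * x)) has_integral (exp (c * b) - exp (c * a)) / c) {a..b}"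
proof -
  have "((\<lambda>x. exp (c * x)) has_integral exp (c * b) / c - exp (c * a) / c) {a..b}"
    using assms
    by (intro fundamental_theorem_of_calculus)
       (auto intro!: derivative_eq_intros simp flip: has_real_derivative_iff_has_vector_derivative)
  then show ?thesis by (simp add: diff_divide_distrib)
qed

section \<open>The Poincare--Miranda theorem\<close>

lemma fun_tendstoI:
  fixes f :: "'b \<Rightarrow> 'i \<Rightarrow> 'c::topological_space"
  assumes "\<And>i. ((\<lambda>k. f k i) \<longlongrightarrow> l i) A"
  shows "(f \<longlongrightarrow> l) A"
  using assms limitin_componentwise[of "\<lambda>_. euclidean" UNIV f l A]
  by (simp add: euclidean_product_topology)

text \<open>The cube has infinitely many coordinates so that the dimension \<open>n\<close> need not be a type.\<close>
lemma poincare_miranda: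
  fixes G :: "(nat \<Rightarrow> real) \<Rightarrow> nat \<Rightarrow> real" and n :: nat
  assumes cont: "\<And>i. i < n \<Longrightarrow> continuous_on (PiE UNIV (\<lambda>_. {0..1})) (\<lambda>x. G x i)"
    and lo: "\<And>x i. x \<in> PiE UNIV (\<lambda>_. {0..1}) \<Longrightarrow> i < n \<Longrightarrow> x i = 0 \<Longrightarrow> G x i \<le> 0"
    and hi: "\<And>x i. x \<in> PiE UNIV (\<lambda>_. {0..1}) \<Longrightarrow> i < n \<Longrightarrow> x i = 1 \<Longrightarrow> 0 \<le> G x i"
  shows "\<exists>x \<in> PiE UNIV (\<lambda>_. {0..1}). \<forall>i<n. G x i = 0"
proof -
  let ?S = "PiE UNIV (\<lambda>_. {0..1}) :: (nat \<Rightarrow> real) set"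
  have S_iff: "x \<in> ?S \<longleftrightarrow> (\<forall>i. 0 \<le> x i \<and> x i \<le> 1)" for x
    by (auto simp: PiE_iff)
  \<comment> \<open>Kuhn's combinatorial lemma on a grid of mesh \<open>1 / Suc k\<close> yields one
    cell, with corner \<open>z\<close>, at whose vertices each of the first \<open>n\<close>
    components of \<open>G\<close> takes both weak signs.\<close>
  have approx: "\<exists>z\<in>?S. \<forall>i<n. \<exists>r\<in>?S. \<exists>s\<in>?S. (\<forall>j. \<bar>r j - z j\<bar> \<le> inverse (real (Suc k)))
      \<and> (\<forall>j. \<bar>s j - z j\<bar> \<le> inverse (real (Suc k))) \<and> G r i \<le> 0 \<and> 0 \<le> G s i" for k
  proof -
    define p where "p = Suc k"
    define pt :: "(nat \<Rightarrow> nat) \<Rightarrow> nat \<Rightarrow> real" where "pt x = (\<lambda>i. if i < n then real (x i) / real p else 0)" for x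
    have p: "0 < p" by (simp add: p_def)
    have pt_S: "pt x \<in> ?S" if "\<And>i. i < n \<Longrightarrow> x i \<le> p" for x
      using that p by (auto simp: S_iff pt_def divide_le_eq_1)
    \<comment> \<open>Labels record the sign of component \<open>i\<close>, overridden on the two
      opposite faces as Kuhn's lemma demands; \<open>lo\<close> and \<open>hi\<close> make the
      overrides agree with the sign.\<close>
    define label where "label x i = (if x i = 0 \<or> x i \<noteq> p \<and> G (pt x) i < 0 then 0 else (1::nat))" for x i
    obtain q where q: "\<forall>i<n. q i < p"
      and rs: "\<forall>i<n. \<exists>r s. (\<forall>j<n. q j \<le> r j \<and> r j \<le> q j + 1) \<and>
          (\<forall>j<n. q j \<le> s j \<and> s j \<le> q j + 1) \<and> label r i \<noteq> label s i"
      by (rule kuhn_lemma[OF p, of n label]) (use p in \<open>auto simp: label_def\<close>)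
    have near: "\<bar>pt r j - pt q j\<bar> \<le> inverse (real (Suc k))" if "\<forall>j<n. q j \<le> r j \<and> r j \<le> q j + 1" for r j
    proof (cases "j < n")
      case True
      then have "\<bar>real (r j) - real (q j)\<bar> \<le> 1" using that by auto
      then have "\<bar>real (r j) - real (q j)\<bar> / real p \<le> 1 / real p"
        by (intro divide_right_mono) auto
      then show ?thesis using True
        by (simp add: pt_def p_def abs_divide inverse_eq_divide flip: diff_divide_distrib)
    qed (simp add: pt_def)
    have in_S: "pt r \<in> ?S" if "\<forall>j<n. q j \<le> r j \<and> r j \<le> q j + 1" for r
      using that q by (intro pt_S) fastforce
    have "\<exists>r\<in>?S. \<exists>s\<in>?S. (\<forall>j. \<bar>r j - pt q j\<bar> \<le> inverse (real (Suc k)))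
      \<and> (\<forall>j. \<bar>s j - pt q j\<bar> \<le> inverse (real (Suc k))) \<and> G r i \<le> 0 \<and> 0 \<le> G s i" if i: "i < n" for i
    proof -
      obtain r s where r: "\<forall>j<n. q j \<le> r j \<and> r j \<le> q j + 1"
        and s: "\<forall>j<n. q j \<le> s j \<and> s j \<le> q j + 1" and ne: "label r i \<noteq> label s i"
        using rs i by blast
      have lab0: "G (pt r) i \<le> 0" if "label r i = 0" "\<forall>j<n. q j \<le> r j \<and> r j \<le> q j + 1" for r
        using that lo[OF in_S[OF that(2)] i] i by (auto simp: label_def pt_def split: if_splits)
      have lab1: "0 \<le> G (pt r) i" if "label r i = 1" "\<forall>j<n. q j \<le> r j \<and> r j \<le> q j + 1" for r
        using that hi[OF in_S[OF that(2)] i] i p by (auto simp: label_def pt_def split: if_splits)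
      consider "label r i = 0" "label s i = 1" | "label s i = 0" "label r i = 1"
        using ne by (auto simp: label_def split: if_splits)
      then show ?thesis
      proof cases
        case 1
        then show ?thesis
          by (intro bexI[of _ "pt r"] bexI[of _ "pt s"] conjI allI near r s lab0 lab1 in_S)
      next
        case 2
        then show ?thesis
          by (intro bexI[of _ "pt s"] bexI[of _ "pt r"] conjI allI near r s lab0 lab1 in_S)
      qed
    qed
    moreover have "pt q \<in> ?S"
      using q by (intro pt_S) (simp add: less_imp_le)
    ultimately show ?thesis by blast
  qed
  then obtain z where z: "\<And>k. z k \<in> ?S" and zrs: "\<And>k. \<forall>i<n. \<exists>r\<in>?S. \<exists>s\<in>?S.
      (\<forall>j. \<bar>r j - z k j\<bar> \<le> inverse (real (Suc k)))
      \<and> (\<forall>j. \<bar>s j - z k j\<bar> \<le> inverse (real (Suc k))) \<and> G r i \<le> 0 \<and> 0 \<le> G s i"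
    by metis
  \<comment> \<open>Tychonoff's theorem; sequential compactness then provides a limit point
    \<open>l\<close> of the cell corners.\<close>
  have "compact ?S"
    using compactin_PiE[of "\<lambda>_. euclidean" UNIV "\<lambda>_::nat. {0..1::real}"]
    by (simp add: euclidean_product_topology)
  then have "seq_compact ?S"
    by (rule compact_imp_seq_compact)
  moreover have "\<forall>k. z k \<in> ?S" using z by blast
  ultimately obtain l \<rho> where l: "l \<in> ?S" and \<rho>: "strict_mono \<rho>" and lim: "(z \<circ> \<rho>) \<longlonglongrightarrow> l"
    by (rule seq_compactE)
  \<comment> \<open>Vertices within the mesh size of \<open>z k\<close> share the limit
    \<open>l\<close>, so both weak signs pass to \<open>G l i\<close>.\<close>
  have close: "(\<lambda>k. G (r (\<rho> k)) i) \<longlonglongrightarrow> G l i"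
    if i: "i < n" and r: "\<And>k. r k \<in> ?S" "\<And>k j. \<bar>r k j - z k j\<bar> \<le> inverse (real (Suc k))" for r i
  proof -
    have "(\<lambda>k. r (\<rho> k)) \<longlonglongrightarrow> l"
    proof (rule fun_tendstoI)
      fix j
      have "(\<lambda>k. inverse (real (Suc (\<rho> k)))) \<longlonglongrightarrow> 0"
        using LIMSEQ_subseq_LIMSEQ[OF LIMSEQ_inverse_real_of_nat \<rho>] by (simp add: o_def)
      then have "(\<lambda>k. r (\<rho> k) j - z (\<rho> k) j) \<longlonglongrightarrow> 0"
        by (rule Lim_null_comparison[rotated]) (simp add: r del: of_nat_Suc)
      moreover have "(\<lambda>k. z (\<rho> k) j) \<longlonglongrightarrow> l j"
        using continuous_on_tendsto_compose[OF continuous_on_product_coordinates lim, of j] by (simp add: o_def)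
      ultimately show "(\<lambda>k. r (\<rho> k) j) \<longlonglongrightarrow> l j"
        using tendsto_add by fastforce
    qed
    then show ?thesis
      by (rule continuous_on_tendsto_compose[OF cont[OF i]]) (use l r in auto)
  qed
  have "G l i = 0" if i: "i < n" for i
  proof -
    have "\<forall>k. \<exists>r s. r \<in> ?S \<and> s \<in> ?S \<and> (\<forall>j. \<bar>r j - z k j\<bar> \<le> inverse (real (Suc k)))
      \<and> (\<forall>j. \<bar>s j - z k j\<bar> \<le> inverse (real (Suc k))) \<and> G r i \<le> 0 \<and> 0 \<le> G s i"
      using zrs i by blast
    then obtain r s where r: "\<And>k. r k \<in> ?S" "\<And>k j. \<bar>r k j - z k j\<bar> \<le> inverse (real (Suc k))" "\<And>k. G (r k) i \<le> 0"
      and s: "\<And>k. s k \<in> ?S" "\<And>k j. \<bar>s k j - z k j\<bar> \<le> inverse (real (Suc k))" "\<And>k. 0 \<le> G (s k) i"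
      by metis
    have "G l i \<le> 0"
      by (rule LIMSEQ_le_const2[OF close[OF i r(1,2)]]) (use r(3) in auto)
    moreover have "0 \<le> G l i"
      by (rule LIMSEQ_le_const[OF close[OF i s(1,2)]]) (use s(3) in auto)
    ultimately show ?thesis by simp
  qed
  then show ?thesis using l by blast
qed

section \<open>Orthonormal bases\<close>

locale hilbert_basis =
  fixes e :: "nat \<Rightarrow> 'a::{real_inner,complete_space}"
  assumes orthonormal: "\<And>i j. e i \<bullet> e j = (if i = j then 1 else 0)"
    and basis: "closure (span (range e)) = UNIV"
begin

lemma inner_sum_basis:
  assumes "finite S"
  shows "(\<Sum>k\<in>S. c k *\<^sub>R e k) \<bullet> e j = (if j \<in> S then c j else 0)"
proof -
  have "(\<Sum>k\<in>S. c k *\<^sub>R e k) \<bullet> e j = (\<Sum>k\<in>S. if k = j then c k else 0)"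
    unfolding inner_sum_left by (rule sum.cong) (auto simp: orthonormal)
  then show ?thesis using assms by simp
qed

lemma norm_sum_basis:
  assumes "finite S"
  shows "(norm (\<Sum>k\<in>S. c k *\<^sub>R e k))\<^sup>2 = (\<Sum>k\<in>S. (c k)\<^sup>2)"
  unfolding power2_norm_eq_inner inner_sum_right using assms
  by (simp add: inner_sum_basis power2_eq_square)

lemma projP_inner: "projP M e u \<bullet> e j = (if j < M then u \<bullet> e j else 0)"
  by (simp add: projP_def inner_sum_basis)

lemma projQ_inner: "projQ M e u \<bullet> e j = (if j < M then 0 else u \<bullet> e j)"
  by (simp add: projQ_def inner_diff_left projP_inner)

lemma bounded_linear_projP: "bounded_linear (projP M e)"
  unfolding projP_def
  by (intro bounded_linear_sum bounded_linear_scaleR_const bounded_linear_inner_left)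

lemma bounded_linear_projQ: "bounded_linear (projQ M e)"
  unfolding projQ_def by (intro bounded_linear_sub bounded_linear_ident bounded_linear_projP)

lemma projP_projQ_orth: "projP M e u \<bullet> projQ M e v = 0"
  unfolding inner_commute[of "projP M e u"] by (simp add: projP_def[of M e u] inner_sum_right projQ_inner)

lemma norm_proj_split: "(norm u)\<^sup>2 = (norm (projP M e u))\<^sup>2 + (norm (projQ M e u))\<^sup>2"
proof -
  have "u = projP M e u + projQ M e u"
    by (simp add: projQ_def)
  then have "u \<bullet> u = (projP M e u + projQ M e u) \<bullet> (projP M e u + projQ M e u)"
    by simp
  then show ?thesis
    by (simp add: power2_norm_eq_inner inner_add_left inner_add_right inner_commute[of "projQ M e u" "projP M e u"] projP_projQ_orth)
qed

lemma norm_projP_le: "norm (projP M e u) \<le> norm u"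
  by (rule power2_le_imp_le) (simp_all add: norm_proj_split[of u M])

lemma norm_projQ_le: "norm (projQ M e u) \<le> norm u"
  by (rule power2_le_imp_le) (simp_all add: norm_proj_split[of u M])

lemma norm_coeff_le: "\<bar>u \<bullet> e j\<bar> \<le> norm u"
proof -
  have "norm (e j) = 1" using orthonormal[of j j] by (simp add: norm_eq_1)
  then show ?thesis using Cauchy_Schwarz_ineq2[of u "e j"] by simp
qed

section \<open>Completeness and compactness expressed through coefficients\<close>

text \<open>On a finite combination \<open>y\<close> of basis vectors the projections are eventually
  the identity. Then \<open>projQ M e\<close> annihilates \<open>y\<close>, and being a contraction
  it bounds the error at \<open>u\<close> by \<open>norm (u - y)\<close>.\<close>

lemma projP_tendsto: "(\<lambda>M. projP M e u) \<longlonglongrightarrow> u"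
proof (rule LIMSEQ_I)
  fix r :: real assume "0 < r"
  then obtain y where y: "y \<in> span (range e)" "dist y u < r"
    using basis by (metis UNIV_I closure_approachable)
  have "\<exists>M0. \<forall>M\<ge>M0. projP M e y = y"
    using y(1)
  proof (induction rule: span_induct_alt)
    case base
    then show ?case by (simp add: projP_def)
  next
    case (step c x y)
    obtain j where x: "x = e j" using step by auto
    have ej: "projP M e (e j) = e j" if "j < M" for M
    proof -
      have "projP M e (e j) = (\<Sum>k<M. (if k = j then e k else 0))"
        unfolding projP_def by (rule sum.cong) (auto simp: orthonormal)
      then show ?thesis using that by simp
    qed
    interpret P: bounded_linear "projP M e" for M by (rule bounded_linear_projP)
    from step obtain M0 where "\<forall>M\<ge>M0. projP M e y = y" by auto
    then have "\<forall>M\<ge>max M0 (Suc j). projP M e (c *\<^sub>R x + y) = c *\<^sub>R x + y"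
      by (auto simp: P.add P.scaleR x ej)
    then show ?case by blast
  qed
  then obtain M0 where M0: "\<And>M. M \<ge> M0 \<Longrightarrow> projP M e y = y" by blast
  show "\<exists>M0. \<forall>M\<ge>M0. norm (projP M e u - u) < r"
  proof (intro exI allI impI)
    fix M assume "M0 \<le> M"
    interpret Q: bounded_linear "projQ M e" by (rule bounded_linear_projQ)
    have "norm (projP M e u - u) = norm (projQ M e (u - y))"
      using M0[OF \<open>M0 \<le> M\<close>] by (simp add: Q.diff) (simp add: projQ_def norm_minus_commute)
    also have "\<dots> \<le> norm (u - y)" by (rule norm_projQ_le)
    also have "\<dots> < r" using y(2) by (simp add: dist_norm norm_minus_commute)
    finally show "norm (projP M e u - u) < r" .
  qed
qed

text \<open>Both vectors are limits of the same finite sums. Identities in the Hilbert space are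
  thereby reduced to scalar ones.\<close>

lemma coeffs_eqI:
  assumes "\<And>j. u \<bullet> e j = v \<bullet> e j"
  shows "u = v"
proof -
  have "projP M e u = projP M e v" for M
    by (simp add: projP_def assms)
  then show ?thesis
    using projP_tendsto[of u] projP_tendsto[of v] LIMSEQ_unique by simp
qed

text \<open>Finite sums of squares are compared and the comparison passes to the limit; this
  replaces Parseval's identity in estimates of diagonal operators.\<close>

lemma norm_le_of_coeffs:
  assumes "0 \<le> C" and "\<And>j. \<bar>u \<bullet> e j\<bar> \<le> C * \<bar>v \<bullet> e j\<bar>"
  shows "norm u \<le> C * norm v"
proof (rule LIMSEQ_le)
  show "(\<lambda>M. norm (projP M e u)) \<longlonglongrightarrow> norm u"
    by (intro tendsto_intros projP_tendsto)
  show "(\<lambda>M. C * norm (projP M e v)) \<longlonglongrightarrow> C * norm v"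
    by (intro tendsto_intros projP_tendsto)
  have "norm (projP M e u) \<le> C * norm (projP M e v)" for M
  proof (rule power2_le_imp_le)
    have "(norm (projP M e u))\<^sup>2 = (\<Sum>k<M. (u \<bullet> e k)\<^sup>2)"
      by (simp add: projP_def norm_sum_basis)
    also have "\<dots> \<le> (\<Sum>k<M. C\<^sup>2 * (v \<bullet> e k)\<^sup>2)"
      using assms by (intro sum_mono) (metis abs_ge_zero power2_abs power_mono power_mult_distrib)
    also have "\<dots> = (C * norm (projP M e v))\<^sup>2"
      by (simp add: projP_def norm_sum_basis power_mult_distrib sum_distrib_left)
    finally show "(norm (projP M e u))\<^sup>2 \<le> (C * norm (projP M e v))\<^sup>2" .
  qed (use assms in auto)
  then show "\<exists>N. \<forall>M\<ge>N. norm (projP M e u) \<le> C * norm (projP M e v)" by blast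
qed

text \<open>The coefficient sequences lie in a product of compact intervals, so by Tychonoff a
  subsequence converges in every coefficient. Uniformly small tails upgrade this to the Cauchy
  property in norm.\<close>

lemma convergent_subseq_of_tails:
  fixes x :: "nat \<Rightarrow> 'a"
  assumes coeff: "\<And>k j. \<bar>x k \<bullet> e j\<bar> \<le> B j"
    and tail: "\<And>k M. M \<ge> N \<Longrightarrow> norm (projQ M e (x k)) \<le> d M"
    and d: "d \<longlonglongrightarrow> 0"
  shows "\<exists>l r. strict_mono r \<and> (x \<circ> r) \<longlonglongrightarrow> l"
proof -
  have "compact (PiE UNIV (\<lambda>j. {- B j..B j}))"
    using compactin_PiE[of "\<lambda>_. euclidean" UNIV "\<lambda>j. {- B j..B j}"]
    by (simp add: euclidean_product_topology)
  then have "seq_compact (PiE UNIV (\<lambda>j. {- B j..B j}))"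
    by (rule compact_imp_seq_compact)
  moreover have "\<forall>k. (\<lambda>j. x k \<bullet> e j) \<in> PiE UNIV (\<lambda>j. {- B j..B j})"
    using coeff by (auto simp: abs_le_iff) (smt (verit) coeff)
  ultimately obtain c r where r: "strict_mono r" and c: "((\<lambda>k j. x k \<bullet> e j) \<circ> r) \<longlonglongrightarrow> c"
    by (rule seq_compactE)
  have cj: "(\<lambda>k. x (r k) \<bullet> e j) \<longlonglongrightarrow> c j" for j
    using continuous_on_tendsto_compose[OF continuous_on_product_coordinates c, of j] by (simp add: o_def)
  have "Cauchy (x \<circ> r)"
  proof (rule metric_CauchyI)
    fix \<epsilon> :: real assume "0 < \<epsilon>"
    \<comment> \<open>Two tails cost less than \<open>\<epsilon> / 4\<close> each, leaving
      \<open>\<epsilon> / 2\<close> for the finitely many low modes.\<close>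
    then have "\<forall>\<^sub>F M in sequentially. d M < \<epsilon> / 4"
      by (intro order_tendstoD(2)[OF d]) simp
    then have "\<forall>\<^sub>F M in sequentially. d M < \<epsilon> / 4 \<and> N \<le> M"
      by (intro eventually_conj eventually_ge_at_top)
    then obtain M where M: "d M < \<epsilon> / 4" "N \<le> M"
      using eventually_happens'[OF sequentially_bot] by blast
    have "(\<lambda>k. projP M e (x (r k))) \<longlonglongrightarrow> (\<Sum>j<M. c j *\<^sub>R e j)"
      unfolding projP_def by (intro tendsto_intros cj)
    then have Cau: "Cauchy (\<lambda>k. projP M e (x (r k)))"
      using LIMSEQ_imp_Cauchy by blast
    obtain k0 where k0: "\<And>k l. k \<ge> k0 \<Longrightarrow> l \<ge> k0 \<Longrightarrow> dist (projP M e (x (r k))) (projP M e (x (r l))) < \<epsilon> / 2"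
      using metric_CauchyD[OF Cau half_gt_zero[OF \<open>0 < \<epsilon>\<close>]] by blast
    have "dist (x (r k)) (x (r l)) < \<epsilon>" if "k \<ge> k0" "l \<ge> k0" for k l
    proof -
      have split: "x (r k) - x (r l) = (projP M e (x (r k)) - projP M e (x (r l))) + (projQ M e (x (r k)) - projQ M e (x (r l)))"
        by (simp add: projQ_def)
      have "norm (x (r k) - x (r l)) \<le> norm (projP M e (x (r k)) - projP M e (x (r l))) + (norm (projQ M e (x (r k))) + norm (projQ M e (x (r l))))"
          unfolding split by (rule order_trans[OF norm_triangle_ineq add_left_mono[OF norm_triangle_ineq4]])
      then show ?thesis
        using k0[OF that] tail[OF M(2), of "r k"] tail[OF M(2), of "r l"] M(1)
        by (simp add: dist_norm)
    qed
    then show "\<exists>M. \<forall>m\<ge>M. \<forall>n\<ge>M. dist ((x \<circ> r) m) ((x \<circ> r) n) < \<epsilon>"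
      by (auto simp: o_def)
  qed
  then show ?thesis
    using r Cauchy_convergent[of "x \<circ> r"] by (auto simp: convergent_def)
qed

text \<open>By Pythagoras each block of the series is no longer than the same block of the expansion
  of \<open>u\<close>, whose partial sums are Cauchy. This makes the series in
  \<open>semigrp\<close> converge.\<close>

lemma summable_dominated_coeffs:
  assumes "\<And>k. \<bar>c k\<bar> \<le> \<bar>u \<bullet> e k\<bar>"
  shows "summable (\<lambda>k. c k *\<^sub>R e k)"
  unfolding summable_iff_convergent
proof (rule Cauchy_convergent, rule CauchyI')
  fix r :: real assume "0 < r"
  have "Cauchy (\<lambda>M. projP M e u)"
    using projP_tendsto by (rule LIMSEQ_imp_Cauchy)
  then obtain M where M: "\<And>m n. m \<ge> M \<Longrightarrow> n \<ge> M \<Longrightarrow> norm (projP m e u - projP n e u) < r"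
    using CauchyD[OF _ \<open>0 < r\<close>] by metis
  have "norm ((\<Sum>k<m. c k *\<^sub>R e k) - (\<Sum>k<n. c k *\<^sub>R e k)) < r" if "m \<ge> M" "n > m" for m n
  proof -
    have diff: "(\<Sum>k<n. d k *\<^sub>R e k) - (\<Sum>k<m. d k *\<^sub>R e k) = (\<Sum>k\<in>{m..<n}. d k *\<^sub>R e k)" for d
      using \<open>n > m\<close> sum_diff_nat_ivl[of 0 m n "\<lambda>k. d k *\<^sub>R e k"] by (simp add: atLeast0LessThan)
    have "norm (\<Sum>k\<in>{m..<n}. c k *\<^sub>R e k) \<le> norm (\<Sum>k\<in>{m..<n}. (u \<bullet> e k) *\<^sub>R e k)"
      by (rule power2_le_imp_le) (auto simp: norm_sum_basis assms intro!: sum_mono abs_le_square_iff[THEN iffD1])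
    also have "\<dots> < r"
      using M[of n m] that diff[of "\<lambda>k. u \<bullet> e k"] by (simp add: projP_def)
    finally show ?thesis
      using diff[of c] by (metis norm_minus_commute)
  qed
  then show "\<exists>M. \<forall>m\<ge>M. \<forall>n>m. dist (\<Sum>k<m. c k *\<^sub>R e k) (\<Sum>k<n. c k *\<^sub>R e k) < r"
    unfolding dist_norm by blast
qed

lemma projQ_tendsto_0: "(\<lambda>M. norm (projQ M e u)) \<longlonglongrightarrow> 0"
proof -
  have "(\<lambda>M. norm (u - projP M e u)) \<longlonglongrightarrow> norm (u - u)"
    by (intro tendsto_intros projP_tendsto)
  then show ?thesis by (simp add: projQ_def)
qed

text \<open>Lets a start in the range of \<open>projP N e\<close> count as zero initial value in the
  tail estimate at every cutoff \<open>M\<close>.\<close>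

lemma projQ_eq_0_mono:
  assumes "projQ N e x = 0" and "N \<le> M"
  shows "projQ M e x = 0"
proof (rule coeffs_eqI)
  fix j
  have "projQ N e x \<bullet> e j = 0" using assms by simp
  then show "projQ M e x \<bullet> e j = 0 \<bullet> e j"
    using assms(2) by (auto simp: projQ_inner split: if_splits)
qed

end

section \<open>The semigroup\<close>

locale spectral = hilbert_basis +
  fixes lam :: "nat \<Rightarrow> real"
  assumes lam_pos: "0 < lam 0" and lam_mono: "mono lam"
    and lam_inf: "filterlim lam at_top sequentially"
begin

lemma lam_gt_0: "0 < lam k"
  using lam_pos monoD[OF lam_mono, of 0 k] by simp

lemma divide_lam_tendsto_0: "(\<lambda>M. K / lam M) \<longlonglongrightarrow> 0"
  by (rule tendsto_divide_0[OF tendsto_const filterlim_at_top_imp_at_infinity[OF lam_inf]])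

text \<open>For nonnegative times all factors are at most 1, so the defining series converges and
  the inner product may be taken termwise.\<close>

lemma semigrp_inner:
  assumes "0 \<le> t"
  shows "semigrp lam e t u \<bullet> e j = exp (- (lam j * t)) * (u \<bullet> e j)"
proof -
  let ?c = "\<lambda>k. exp (- (lam k * t)) * (u \<bullet> e k)"
  have "\<bar>?c k\<bar> \<le> \<bar>u \<bullet> e k\<bar>" for k
    using assms lam_gt_0[of k] by (simp add: abs_mult mult_left_le_one_le less_imp_le)
  then have "(\<lambda>k. ?c k *\<^sub>R e k) sums semigrp lam e t u"
    unfolding semigrp_def by (intro summable_sums summable_dominated_coeffs[of _ u])
  then have "(\<lambda>k. (?c k *\<^sub>R e k) \<bullet> e j) sums (semigrp lam e t u \<bullet> e j)"
    by (rule bounded_linear.sums[OF bounded_linear_inner_left])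
  moreover have "(\<lambda>k. (?c k *\<^sub>R e k) \<bullet> e j) = (\<lambda>k. if k = j then ?c k else 0)"
    by (auto simp: orthonormal)
  ultimately have "(\<lambda>k. if k = j then ?c k else 0) sums (semigrp lam e t u \<bullet> e j)"
    by simp
  then show ?thesis
    using sums_single[of j ?c] by (rule sums_unique2)
qed

lemma semigrp_diff:
  assumes "0 \<le> t"
  shows "semigrp lam e t (u - v) = semigrp lam e t u - semigrp lam e t v"
  by (rule coeffs_eqI) (simp add: semigrp_inner assms inner_diff_left algebra_simps)

text \<open>Among the modes from \<open>M\<close> on, mode \<open>M\<close> decays most slowly
  because \<open>lam\<close> is monotone.\<close>

lemma norm_projQ_semigrp:
  assumes "0 \<le> t"
  shows "norm (projQ M e (semigrp lam e t u)) \<le> exp (- (lam M * t)) * norm (projQ M e u)"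
proof (rule norm_le_of_coeffs)
  fix j
  have "exp (- (lam j * t)) \<le> exp (- (lam M * t))" if "M \<le> j"
    using monoD[OF lam_mono that] assms by (simp add: mult_right_mono)
  then show "\<bar>projQ M e (semigrp lam e t u) \<bullet> e j\<bar> \<le> exp (- (lam M * t)) * \<bar>projQ M e u \<bullet> e j\<bar>"
    by (simp add: projQ_inner semigrp_inner assms abs_mult mult_right_mono)
qed simp

lemma norm_semigrp_le:
  assumes "0 \<le> t"
  shows "norm (semigrp lam e t u) \<le> norm u"
proof -
  have "norm (semigrp lam e t u) \<le> 1 * norm u"
    using assms lam_gt_0
    by (intro norm_le_of_coeffs) (simp_all add: semigrp_inner abs_mult mult_left_le_one_le less_imp_le)
  then show ?thesis by simp
qed

text \<open>The finite partial sums are continuous and converge uniformly: the error at any time is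
  at most the tail of \<open>u\<close> itself.\<close>

lemma continuous_on_semigrp: "continuous_on {0..} (\<lambda>t. semigrp lam e t u)"
proof (rule uniform_limit_theorem)
  let ?f = "\<lambda>M t. \<Sum>k<M. (exp (- (lam k * t)) * (u \<bullet> e k)) *\<^sub>R e k"
  show "\<forall>\<^sub>F M in sequentially. continuous_on {0..} (?f M)"
    by (intro always_eventually allI continuous_intros)
  show "uniform_limit {0..} ?f (\<lambda>t. semigrp lam e t u) sequentially"
  proof (rule uniform_limitI)
    fix r :: real assume "0 < r"
    have "\<forall>\<^sub>F M in sequentially. norm (projQ M e u) < r"
      by (rule order_tendstoD(2)[OF projQ_tendsto_0 \<open>0 < r\<close>])
    then show "\<forall>\<^sub>F M in sequentially. \<forall>t\<in>{0..}. dist (?f M t) (semigrp lam e t u) < r"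
    proof eventually_elim
      case (elim M)
      have "dist (?f M t) (semigrp lam e t u) < r" if "0 \<le> t" for t
      proof -
        have "?f M t = projP M e (semigrp lam e t u)"
          by (simp add: projP_def semigrp_inner that)
        then have "dist (?f M t) (semigrp lam e t u) = norm (projQ M e (semigrp lam e t u))"
          by (simp add: projQ_def dist_norm norm_minus_commute)
        also have "\<dots> \<le> exp (- (lam M * t)) * norm (projQ M e u)"
          by (rule norm_projQ_semigrp[OF that])
        also have "\<dots> \<le> norm (projQ M e u)"
          using that lam_gt_0[of M] by (simp add: mult_left_le_one_le)
        finally show ?thesis using elim by simp
      qed
      then show ?case by simp
    qed
  qed
qed simp

text \<open>With strong continuity at hand, the difference is split: \<open>g \<tau> - g x\<close>
  is controlled by contractivity, and the rest is the orbit of the fixed vector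
  \<open>g x\<close>.\<close>

lemma continuous_on_semigrp_compose:
  assumes g: "continuous_on {s..t} g"
  shows "continuous_on {s..t} (\<lambda>\<tau>. semigrp lam e (t - \<tau>) (g \<tau>))"
  unfolding continuous_on_def
proof
  fix x assume x: "x \<in> {s..t}"
  let ?W = "at x within {s..t}"
  have in_st: "\<forall>\<^sub>F \<tau> in ?W. \<tau> \<in> {s..t}"
    by (auto simp: eventually_at_filter)
  have "((\<lambda>\<tau>. g \<tau> - g x) \<longlongrightarrow> 0) ?W"
    using g x by (auto simp: continuous_on_def intro: LIM_zero)
  then have "((\<lambda>\<tau>. norm (g \<tau> - g x)) \<longlongrightarrow> 0) ?W"
    by (rule tendsto_norm_zero)
  then have 1: "((\<lambda>\<tau>. semigrp lam e (t - \<tau>) (g \<tau> - g x)) \<longlongrightarrow> 0) ?W"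
    by (rule Lim_null_comparison[rotated])
       (use in_st in \<open>eventually_elim, auto intro!: norm_semigrp_le\<close>)
  have "continuous_on {s..t} (\<lambda>\<tau>. semigrp lam e (t - \<tau>) (g x))"
    by (rule continuous_on_compose2[OF continuous_on_semigrp]) (auto intro!: continuous_intros)
  then have "((\<lambda>\<tau>. semigrp lam e (t - \<tau>) (g x)) \<longlongrightarrow> semigrp lam e (t - x) (g x)) ?W"
    using x by (auto simp: continuous_on_def)
  from tendsto_add[OF 1 this]
  have "((\<lambda>\<tau>. semigrp lam e (t - \<tau>) (g \<tau> - g x) + semigrp lam e (t - \<tau>) (g x)) \<longlongrightarrow> semigrp lam e (t - x) (g x)) ?W"
    by simp
  then show "((\<lambda>\<tau>. semigrp lam e (t - \<tau>) (g \<tau>)) \<longlongrightarrow> semigrp lam e (t - x) (g x)) ?W"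
    by (rule Lim_transform_eventually)
       (use in_st in \<open>eventually_elim, simp add: semigrp_diff\<close>)
qed

text \<open>The factor \<open>exp (lam j * t)\<close> removes the end time from the integrand, so
  that integrals with different end times can be compared.\<close>

lemma has_integral_semigrp_coeff:
  assumes "((\<lambda>\<tau>. semigrp lam e (t - \<tau>) (g \<tau>)) has_integral I) {s..t}"
  shows "((\<lambda>\<tau>. exp (lam j * \<tau>) * (g \<tau> \<bullet> e j)) has_integral exp (lam j * t) * (I \<bullet> e j)) {s..t}"
proof -
  have "((\<lambda>\<tau>. exp (lam j * t) * (semigrp lam e (t - \<tau>) (g \<tau>) \<bullet> e j)) has_integral exp (lam j * t) * (I \<bullet> e j)) {s..t}"
    using has_integral_linear[OF assms bounded_linear_inner_left, of "e j"]
    by (intro has_integral_mult_right) (simp add: o_def)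
  then show ?thesis
  proof (rule has_integral_eq[rotated])
    fix \<tau> assume "\<tau> \<in> {s..t}"
    moreover have "exp (lam j * t) * exp (- (lam j * (t - \<tau>))) = exp (lam j * \<tau>)"
      by (simp add: algebra_simps flip: exp_add)
    ultimately show "exp (lam j * t) * (semigrp lam e (t - \<tau>) (g \<tau>) \<bullet> e j) = exp (lam j * \<tau>) * (g \<tau> \<bullet> e j)"
      by (simp add: semigrp_inner flip: mult.assoc)
  qed
qed

end

section \<open>Mild solutions\<close>

locale semilinear = spectral e lam
  for e :: "nat \<Rightarrow> 'a::{real_inner,complete_space}" and lam +
  fixes F :: "'a \<Rightarrow> 'a" and K0 K1 :: real
  assumes K1_pos: "0 < K1"
    and F_bdd: "\<And>u. norm (F u) \<le> K0"
    and F_lip: "\<And>u v. norm (F u - F v) \<le> K1 * norm (u - v)"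
begin

text \<open>The variation of constants formula for \<open>v\<close> with forcing \<open>F \<circ> w\<close>, tested against the
  eigenvectors and multiplied by the integrating factor. Allowing \<open>w \<noteq> v\<close> covers Picard iteration,
  and the formula is visibly additive in time and stable under limits.\<close>
definition duhamel :: "(real \<Rightarrow> 'a) \<Rightarrow> (real \<Rightarrow> 'a) \<Rightarrow> real \<Rightarrow> real \<Rightarrow> bool" where
  "duhamel w v s t \<longleftrightarrow> (\<forall>j. ((\<lambda>\<tau>. exp (lam j * \<tau>) * (F (w \<tau>) \<bullet> e j)) has_integral
      (exp (lam j * t) * (v t \<bullet> e j) - exp (lam j * s) * (v s \<bullet> e j))) {s..t})"

lemma continuous_on_F: "continuous_on X w \<Longrightarrow> continuous_on X (\<lambda>\<tau>. F (w \<tau>))"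
proof -
  have "K1-lipschitz_on UNIV F"
    using F_lip K1_pos by (intro lipschitz_onI) (auto simp: dist_norm)
  then have "continuous_on UNIV F"
    by (rule lipschitz_on_continuous_on)
  then show "continuous_on X w \<Longrightarrow> continuous_on X (\<lambda>\<tau>. F (w \<tau>))"
    using continuous_on_compose2 by blast
qed

lemma K0_nonneg: "0 \<le> K0"
  using F_bdd[of 0] norm_ge_zero[of "F 0"] by linarith

text \<open>Continuity guarantees that the vector-valued integral exists; its value is then
  determined by its coefficients, since the integrating factors never vanish.\<close>

lemma duhamel_iff:
  assumes "s \<le> t" and w: "continuous_on {s..t} w"
  shows "duhamel w v s t \<longleftrightarrow> ((\<lambda>\<tau>. semigrp lam e (t - \<tau>) (F (w \<tau>))) has_integral
      (v t - semigrp lam e (t - s) (v s))) {s..t}"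
proof -
  obtain I where I: "((\<lambda>\<tau>. semigrp lam e (t - \<tau>) (F (w \<tau>))) has_integral I) {s..t}"
    using continuous_imp_integrable_on_interval[OF continuous_on_semigrp_compose[OF continuous_on_F[OF w]]]
    by (auto simp: integrable_on_def)
  have coeff: "exp (lam j * t) * ((v t - semigrp lam e (t - s) (v s)) \<bullet> e j)
      = exp (lam j * t) * (v t \<bullet> e j) - exp (lam j * s) * (v s \<bullet> e j)" for j
  proof -
    have "exp (lam j * t) * exp (- (lam j * (t - s))) = exp (lam j * s)"
      by (simp add: algebra_simps flip: exp_add)
    then show ?thesis
      using \<open>s \<le> t\<close> by (simp add: inner_diff_left semigrp_inner right_diff_distrib flip: mult.assoc)
  qed
  note Ij = has_integral_semigrp_coeff[OF I]
  show ?thesis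
  proof
    assume "duhamel w v s t"
    then have "exp (lam j * t) * (I \<bullet> e j) = exp (lam j * t) * ((v t - semigrp lam e (t - s) (v s)) \<bullet> e j)" for j
      unfolding coeff duhamel_def by (intro has_integral_unique[OF Ij]) blast
    then have "I = v t - semigrp lam e (t - s) (v s)"
      by (intro coeffs_eqI) simp
    then show "((\<lambda>\<tau>. semigrp lam e (t - \<tau>) (F (w \<tau>))) has_integral
      (v t - semigrp lam e (t - s) (v s))) {s..t}"
      using I by simp
  next
    assume "((\<lambda>\<tau>. semigrp lam e (t - \<tau>) (F (w \<tau>))) has_integral
      (v t - semigrp lam e (t - s) (v s))) {s..t}"
    from has_integral_semigrp_coeff[OF this] show "duhamel w v s t"
      unfolding duhamel_def coeff by blast
  qed
qed

text \<open>Order-convexity of \<open>J\<close> keeps every interval of integration inside the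
  domain of continuity.\<close>

lemma mild_solution_iff:
  assumes "\<And>s t. s \<in> J \<Longrightarrow> t \<in> J \<Longrightarrow> {s..t} \<subseteq> J"
  shows "mild_solution lam e F J u \<longleftrightarrow>
    continuous_on J u \<and> (\<forall>s\<in>J. \<forall>t\<in>J. s \<le> t \<longrightarrow> duhamel u u s t)"
proof -
  have "duhamel u u s t \<longleftrightarrow> ((\<lambda>\<tau>. semigrp lam e (t - \<tau>) (F (u \<tau>))) has_integral
      (u t - semigrp lam e (t - s) (u s))) {s..t}"
    if "continuous_on J u" "s \<in> J" "t \<in> J" "s \<le> t" for s t
    using that assms[of s t] by (intro duhamel_iff) (auto intro: continuous_on_subset)
  then show ?thesis unfolding mild_solution_def by blast
qed

lemma mild_solution_continuous: "mild_solution lam e F J u \<Longrightarrow> continuous_on J u"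
  by (simp add: mild_solution_def)

lemma mild_solution_duhamel:
  assumes u: "mild_solution lam e F J u" and J: "{s..t} \<subseteq> J" and "s \<le> t"
  shows "duhamel u u s t"
proof -
  have "continuous_on {s..t} u"
    using mild_solution_continuous[OF u] J by (rule continuous_on_subset)
  moreover have "s \<in> J" "t \<in> J"
    using J \<open>s \<le> t\<close> by auto
  ultimately show ?thesis
    using u \<open>s \<le> t\<close> by (simp add: duhamel_iff mild_solution_def)
qed

text \<open>The equation is autonomous: the substitution only contributes the common factor
  \<open>exp (lam j * c)\<close>, which is divided out.\<close>

lemma duhamel_shift: "duhamel (\<lambda>\<tau>. w (\<tau> + c)) (\<lambda>\<tau>. v (\<tau> + c)) s t" if D: "duhamel w v (s + c) (t + c)"
  unfolding duhamel_def
proof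
  fix j
  let ?A = "exp (lam j * (t + c)) * (v (t + c) \<bullet> e j) - exp (lam j * (s + c)) * (v (s + c) \<bullet> e j)"
  have "((\<lambda>\<tau>. exp (lam j * \<tau>) * (F (w \<tau>) \<bullet> e j)) has_integral ?A) (cbox (s + c) (t + c))"
    using D by (simp add: duhamel_def)
  from has_integral_affinity'[OF this, of 1 c]
  have "((\<lambda>\<tau>. exp (lam j * (\<tau> + c)) * (F (w (\<tau> + c)) \<bullet> e j)) has_integral ?A) {s..t}"
    by simp
  from has_integral_mult_right[OF this, of "exp (- (lam j * c))"]
  show "((\<lambda>\<tau>. exp (lam j * \<tau>) * (F (w (\<tau> + c)) \<bullet> e j)) has_integral
      exp (lam j * t) * (v (t + c) \<bullet> e j) - exp (lam j * s) * (v (s + c) \<bullet> e j)) {s..t}"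
    by (simp add: distrib_left exp_add exp_minus right_diff_distrib field_simps)
qed

text \<open>Follows by subtraction from additivity of the integral. A formula known only from the
  initial time thus holds between any two times.\<close>

lemma duhamel_remainder:
  assumes "a \<le> s" "s \<le> t" and w: "continuous_on {a..t} w"
    and as: "duhamel w v a s" and at: "duhamel w v a t"
  shows "duhamel w v s t"
  unfolding duhamel_def
proof
  fix j
  let ?f = "\<lambda>\<tau>. exp (lam j * \<tau>) * (F (w \<tau>) \<bullet> e j)"
  have "continuous_on {s..t} ?f"
    using w \<open>a \<le> s\<close> by (intro continuous_intros continuous_on_F) (auto intro: continuous_on_subset)
  then obtain I where I: "(?f has_integral I) {s..t}"
    using integrable_continuous_real by blast
  have "(?f has_integral (exp (lam j * s) * (v s \<bullet> e j) - exp (lam j * a) * (v a \<bullet> e j)) + I) {a..t}"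
    using as assms(1,2) I by (intro has_integral_combine[of a s t]) (auto simp: duhamel_def)
  moreover have "(?f has_integral exp (lam j * t) * (v t \<bullet> e j) - exp (lam j * a) * (v a \<bullet> e j)) {a..t}"
    using at by (auto simp: duhamel_def)
  ultimately have "(exp (lam j * s) * (v s \<bullet> e j) - exp (lam j * a) * (v a \<bullet> e j)) + I
      = exp (lam j * t) * (v t \<bullet> e j) - exp (lam j * a) * (v a \<bullet> e j)"
    by (rule has_integral_unique)
  then have "I = exp (lam j * t) * (v t \<bullet> e j) - exp (lam j * s) * (v s \<bullet> e j)"
    by simp
  then show "(?f has_integral exp (lam j * t) * (v t \<bullet> e j) - exp (lam j * s) * (v s \<bullet> e j)) {s..t}"
    using I by simp
qed

section \<open>A priori bounds, dependence on data, passage to the limit\<close>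

text \<open>Integrating the decay \<open>exp (- (lam M * (t - \<tau>)))\<close> against the bound
  \<open>K0\<close> gives at most \<open>K0 / lam M\<close>, however long the elapsed time. This
  uniformity is the source of all compactness below.\<close>

lemma duhamel_tail_bound:
  assumes "s \<le> t" and w: "continuous_on {s..t} w" and D: "duhamel w v s t"
  shows "norm (projQ M e (v t)) \<le> norm (projQ M e (v s)) + K0 / lam M"
proof -
  interpret Q: bounded_linear "projQ M e" by (rule bounded_linear_projQ)
  let ?S = "semigrp lam e"
  have "((\<lambda>\<tau>. ?S (t - \<tau>) (F (w \<tau>))) has_integral v t - ?S (t - s) (v s)) {s..t}"
    using D duhamel_iff[OF assms(1,2)] by simp
  from has_integral_linear[OF this bounded_linear_projQ, of M]
  have 1: "((\<lambda>\<tau>. projQ M e (?S (t - \<tau>) (F (w \<tau>)))) has_integral projQ M e (v t - ?S (t - s) (v s))) {s..t}"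
    by (simp add: o_def)
  \<comment> \<open>The majorant \<open>K0 * exp (- (lam M * (t - \<tau>)))\<close>, factored so
    that its integral is explicit.\<close>
  have 2: "((\<lambda>\<tau>. (K0 * exp (- (lam M * t))) * exp (lam M * \<tau>)) has_integral
      (K0 * exp (- (lam M * t))) * ((exp (lam M * t) - exp (lam M * s)) / lam M)) {s..t}"
    using lam_gt_0[of M] \<open>s \<le> t\<close> by (intro has_integral_mult_right has_integral_exp) auto
  have "norm (projQ M e (v t - ?S (t - s) (v s))) \<le> (K0 * exp (- (lam M * t))) * ((exp (lam M * t) - exp (lam M * s)) / lam M)"
  proof (rule has_integral_norm_bound[OF 1 2])
    fix \<tau> assume \<tau>: "\<tau> \<in> {s..t}"
    have "norm (projQ M e (?S (t - \<tau>) (F (w \<tau>)))) \<le> exp (- (lam M * (t - \<tau>))) * norm (projQ M e (F (w \<tau>)))"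
      using \<tau> by (intro norm_projQ_semigrp) simp
    also have "\<dots> \<le> exp (- (lam M * (t - \<tau>))) * K0"
      using norm_projQ_le F_bdd by (intro mult_left_mono) (auto intro: order_trans)
    also have "\<dots> = (K0 * exp (- (lam M * t))) * exp (lam M * \<tau>)"
      by (simp add: algebra_simps exp_add exp_diff exp_minus field_simps)
    finally show "norm (projQ M e (?S (t - \<tau>) (F (w \<tau>)))) \<le> (K0 * exp (- (lam M * t))) * exp (lam M * \<tau>)" .
  qed
  also have "\<dots> = K0 / lam M * (exp (- (lam M * t)) * (exp (lam M * t) - exp (lam M * s)))"
    by simp
  also have "\<dots> \<le> K0 / lam M * 1"
    using K0_nonneg lam_gt_0[of M]
    by (intro mult_left_mono) (auto simp: right_diff_distrib simp flip: exp_add)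
  finally have "norm (projQ M e (v t - ?S (t - s) (v s))) \<le> K0 / lam M" by simp
  moreover have "norm (projQ M e (?S (t - s) (v s))) \<le> norm (projQ M e (v s))"
  proof -
    have "norm (projQ M e (?S (t - s) (v s))) \<le> exp (- (lam M * (t - s))) * norm (projQ M e (v s))"
      using \<open>s \<le> t\<close> by (intro norm_projQ_semigrp) simp
    also have "\<dots> \<le> norm (projQ M e (v s))"
      using \<open>s \<le> t\<close> lam_gt_0[of M] by (simp add: mult_left_le_one_le)
    finally show ?thesis .
  qed
  ultimately show ?thesis
    using norm_triangle_ineq2[of "projQ M e (v t)" "projQ M e (?S (t - s) (v s))"]
    by (simp add: Q.diff)
qed

text \<open>The weight \<open>exp (lam j * \<tau>)\<close> is largest at the end time. The estimate
  can be read in both directions: it also controls the coefficient at \<open>s\<close> by the one at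
  \<open>t\<close>.\<close>

lemma duhamel_coeff_bound:
  assumes "s \<le> t" and D: "duhamel w v s t"
  shows "\<bar>exp (lam j * t) * (v t \<bullet> e j) - exp (lam j * s) * (v s \<bullet> e j)\<bar> \<le> exp (lam j * t) * K0 * (t - s)"
proof -
  have "norm (exp (lam j * t) * (v t \<bullet> e j) - exp (lam j * s) * (v s \<bullet> e j)) \<le> exp (lam j * t) * K0 * measure lborel (cbox s t)"
  proof (rule has_integral_bound)
    show "((\<lambda>\<tau>. exp (lam j * \<tau>) * (F (w \<tau>) \<bullet> e j)) has_integral
       exp (lam j * t) * (v t \<bullet> e j) - exp (lam j * s) * (v s \<bullet> e j)) (cbox s t)"
      using D by (simp add: duhamel_def)
    fix \<tau> assume "\<tau> \<in> cbox s t"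
    then have "exp (lam j * \<tau>) \<le> exp (lam j * t)"
      using lam_gt_0[of j] by simp
    then show "norm (exp (lam j * \<tau>) * (F (w \<tau>) \<bullet> e j)) \<le> exp (lam j * t) * K0"
      using norm_coeff_le[of "F (w \<tau>)" j] F_bdd[of "w \<tau>"]
      by (auto simp: abs_mult intro!: mult_mono)
  qed (use K0_nonneg in simp)
  then show ?thesis using \<open>s \<le> t\<close> by simp
qed

text \<open>Contractivity of the semigroup and the Lipschitz bound. The free majorant
  \<open>g\<close> lets one estimate serve both Gronwall's inequality and the weighted Picard
  iteration.\<close>

lemma duhamel_diff_bound:
  assumes "s \<le> t" and w: "continuous_on {s..t} w" and w': "continuous_on {s..t} w'"
    and D: "duhamel w v s t" and D': "duhamel w' v' s t"
    and g: "(g has_integral J) {s..t}"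
    and le: "\<And>\<tau>. \<tau> \<in> {s..t} \<Longrightarrow> K1 * norm (w \<tau> - w' \<tau>) \<le> g \<tau>"
  shows "norm (v t - v' t) \<le> norm (v s - v' s) + J"
proof -
  let ?S = "semigrp lam e"
  have "((\<lambda>\<tau>. ?S (t - \<tau>) (F (w \<tau>)) - ?S (t - \<tau>) (F (w' \<tau>))) has_integral
     (v t - ?S (t - s) (v s)) - (v' t - ?S (t - s) (v' s))) {s..t}"
    using D D' duhamel_iff[OF \<open>s \<le> t\<close>] w w' by (intro has_integral_diff) auto
  then have "norm ((v t - ?S (t - s) (v s)) - (v' t - ?S (t - s) (v' s))) \<le> J"
  proof (rule has_integral_norm_bound[OF _ g])
    fix \<tau> assume \<tau>: "\<tau> \<in> {s..t}"
    then have "norm (?S (t - \<tau>) (F (w \<tau>)) - ?S (t - \<tau>) (F (w' \<tau>))) \<le> norm (F (w \<tau>) - F (w' \<tau>))"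
      using norm_semigrp_le[of "t - \<tau>" "F (w \<tau>) - F (w' \<tau>)"] by (simp add: semigrp_diff)
    then show "norm (?S (t - \<tau>) (F (w \<tau>)) - ?S (t - \<tau>) (F (w' \<tau>))) \<le> g \<tau>"
      using F_lip[of "w \<tau>" "w' \<tau>"] le[OF \<tau>] by linarith
  qed
  moreover have "(v t - ?S (t - s) (v s)) - (v' t - ?S (t - s) (v' s)) = (v t - v' t) - ?S (t - s) (v s - v' s)"
    using \<open>s \<le> t\<close> by (simp add: semigrp_diff)
  moreover have "norm (?S (t - s) (v s - v' s)) \<le> norm (v s - v' s)"
    using \<open>s \<le> t\<close> by (intro norm_semigrp_le) simp
  ultimately show ?thesis
    using norm_triangle_ineq2[of "v t - v' t" "?S (t - s) (v s - v' s)"] by simp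
qed

text \<open>Used for continuity of the time-\<open>T\<close> map in shooting, and to spread
  convergence at one time to all later times up to 0.\<close>

lemma duhamel_gronwall:
  assumes u: "continuous_on {a..b} u" and v: "continuous_on {a..b} v"
    and Du: "\<And>t. t \<in> {a..b} \<Longrightarrow> duhamel u u a t" and Dv: "\<And>t. t \<in> {a..b} \<Longrightarrow> duhamel v v a t"
    and t: "t \<in> {a..b}"
  shows "norm (u t - v t) \<le> norm (u a - v a) * exp (K1 * (t - a))"
proof (rule gronwall_integral[OF _ _ _ t])
  show "continuous_on {a..b} (\<lambda>t. norm (u t - v t))"
    by (intro continuous_intros u v)
  fix t assume t: "t \<in> {a..b}"
  have cont: "continuous_on {a..t} u" "continuous_on {a..t} v"
    using u v t by (auto intro: continuous_on_subset)
  have int: "((\<lambda>t. K1 * norm (u t - v t)) has_integral K1 * integral {a..t} (\<lambda>t. norm (u t - v t))) {a..t}"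
    using cont by (intro has_integral_mult_right integrable_integral integrable_continuous_real continuous_intros)
  show "norm (u t - v t) \<le> norm (u a - v a) + K1 * integral {a..t} (\<lambda>t. norm (u t - v t))"
    using t by (intro duhamel_diff_bound[OF _ cont Du Dv int]) auto
qed (use K1_pos in simp)

text \<open>The tested integrands converge uniformly since \<open>F\<close> is Lipschitz, so their
  integrals converge. Of \<open>v\<close> only the two end values enter.\<close>

lemma duhamel_limit:
  assumes lim: "uniform_limit {s..t} w u sequentially"
    and w: "\<And>m. continuous_on {s..t} (w m)"
    and s: "(\<lambda>m. v m s) \<longlonglongrightarrow> v' s" and t: "(\<lambda>m. v m t) \<longlonglongrightarrow> v' t"
    and D: "\<And>m. duhamel (w m) (v m) s t"
  shows "duhamel u v' s t"
  unfolding duhamel_def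
proof
  fix j
  have "uniform_limit {s..t} (\<lambda>m \<tau>. exp (lam j * \<tau>) * (F (w m \<tau>) \<bullet> e j)) (\<lambda>\<tau>. exp (lam j * \<tau>) * (F (u \<tau>) \<bullet> e j)) sequentially"
  proof (rule uniform_limitI)
    fix r :: real assume "0 < r"
    let ?C = "exp (lam j * t) * K1"
    have "0 < ?C" using K1_pos by simp
    with \<open>0 < r\<close> have "\<forall>\<^sub>F m in sequentially. \<forall>\<tau>\<in>{s..t}. dist (w m \<tau>) (u \<tau>) < r / ?C"
      by (intro uniform_limitD[OF lim]) simp
    then show "\<forall>\<^sub>F m in sequentially. \<forall>\<tau>\<in>{s..t}.
        dist (exp (lam j * \<tau>) * (F (w m \<tau>) \<bullet> e j)) (exp (lam j * \<tau>) * (F (u \<tau>) \<bullet> e j)) < r"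
    proof (eventually_elim, intro ballI)
      fix m \<tau> assume *: "\<forall>\<tau>\<in>{s..t}. dist (w m \<tau>) (u \<tau>) < r / ?C" and \<tau>: "\<tau> \<in> {s..t}"
      have "dist (exp (lam j * \<tau>) * (F (w m \<tau>) \<bullet> e j)) (exp (lam j * \<tau>) * (F (u \<tau>) \<bullet> e j))
          = exp (lam j * \<tau>) * \<bar>(F (w m \<tau>) - F (u \<tau>)) \<bullet> e j\<bar>"
        by (simp add: dist_real_def inner_diff_left abs_mult flip: right_diff_distrib)
      also have "\<dots> \<le> exp (lam j * t) * (K1 * norm (w m \<tau> - u \<tau>))"
        using \<tau> lam_gt_0[of j] order_trans[OF norm_coeff_le F_lip]
        by (intro mult_mono) auto
      also have "\<dots> = ?C * dist (w m \<tau>) (u \<tau>)" by (simp add: dist_norm)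
      also have "\<dots> < r"
        using * \<tau> \<open>0 < ?C\<close> by (metis mult.commute pos_less_divide_eq)
      finally show "dist (exp (lam j * \<tau>) * (F (w m \<tau>) \<bullet> e j)) (exp (lam j * \<tau>) * (F (u \<tau>) \<bullet> e j)) < r" .
    qed
  qed
  then obtain I J where I: "\<And>m. ((\<lambda>\<tau>. exp (lam j * \<tau>) * (F (w m \<tau>) \<bullet> e j)) has_integral I m) {s..t}"
    and J: "((\<lambda>\<tau>. exp (lam j * \<tau>) * (F (u \<tau>) \<bullet> e j)) has_integral J) {s..t}" and IJ: "I \<longlonglongrightarrow> J"
    by (rule uniform_limit_integral) (auto intro!: continuous_intros continuous_on_F w)
  have "I m = exp (lam j * t) * (v m t \<bullet> e j) - exp (lam j * s) * (v m s \<bullet> e j)" for m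
    using D[of m] I[of m] has_integral_unique unfolding duhamel_def by blast
  then have "I = (\<lambda>m. exp (lam j * t) * (v m t \<bullet> e j) - exp (lam j * s) * (v m s \<bullet> e j))"
    by blast
  moreover have "\<dots> \<longlonglongrightarrow> exp (lam j * t) * (v' t \<bullet> e j) - exp (lam j * s) * (v' s \<bullet> e j)"
    by (intro tendsto_intros s t)
  ultimately have "J = exp (lam j * t) * (v' t \<bullet> e j) - exp (lam j * s) * (v' s \<bullet> e j)"
    using IJ LIMSEQ_unique by blast
  then show "((\<lambda>\<tau>. exp (lam j * \<tau>) * (F (u \<tau>) \<bullet> e j)) has_integral
     exp (lam j * t) * (v' t \<bullet> e j) - exp (lam j * s) * (v' s \<bullet> e j)) {s..t}"
    using J by simp
qed

section \<open>Existence of solutions and shooting for prescribed low modes\<close>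

text \<open>The formula itself defines \<open>v\<close>. Its continuity is delicate because
  \<open>t\<close> enters the integrand too; each coefficient is continuous, and the tail bound
  makes the finite sums converge uniformly in \<open>t\<close>.\<close>

lemma picard_step:
  assumes w: "continuous_on {0..T} w"
  shows "\<exists>v. continuous_on {0..T} v \<and> v 0 = x \<and> (\<forall>t\<in>{0..T}. duhamel w v 0 t)"
proof -
  let ?S = "semigrp lam e"
  define v where "v t = ?S t x + integral {0..t} (\<lambda>\<tau>. ?S (t - \<tau>) (F (w \<tau>)))" for t
  have v0: "v 0 = x"
  proof -
    have "?S 0 x = x" by (rule coeffs_eqI) (simp add: semigrp_inner)
    then show ?thesis by (simp add: v_def)
  qed
  have cw: "continuous_on {0..t} w" if "t \<in> {0..T}" for t
    using w that by (auto intro: continuous_on_subset)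
  have D: "duhamel w v 0 t" if t: "t \<in> {0..T}" for t
  proof -
    have "(\<lambda>\<tau>. ?S (t - \<tau>) (F (w \<tau>))) integrable_on {0..t}"
      by (intro continuous_imp_integrable_on_interval continuous_on_semigrp_compose continuous_on_F cw[OF t])
    then show ?thesis
      using t v0 cw[OF t] by (subst duhamel_iff) (auto simp: v_def integrable_integral)
  qed
  have coeff: "continuous_on {0..T} (\<lambda>t. v t \<bullet> e j)" for j
  proof -
    let ?f = "\<lambda>\<tau>. exp (lam j * \<tau>) * (F (w \<tau>) \<bullet> e j)"
    have "v t \<bullet> e j = exp (- (lam j * t)) * (x \<bullet> e j + integral {0..t} ?f)" if "t \<in> {0..T}" for t
    proof -
      have "integral {0..t} ?f = exp (lam j * t) * (v t \<bullet> e j) - x \<bullet> e j"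
        using D[OF that] v0 by (intro integral_unique) (simp add: duhamel_def)
      then show ?thesis by (simp add: exp_minus field_simps)
    qed
    moreover have "continuous_on {0..T} (\<lambda>t. exp (- (lam j * t)) * (x \<bullet> e j + integral {0..t} ?f))"
      by (intro continuous_intros indefinite_integral_continuous_1 integrable_continuous_real continuous_on_F w)
    ultimately show ?thesis
      using continuous_on_cong[OF refl] by (metis (no_types, lifting))
  qed
  have "continuous_on {0..T} v"
  proof (rule uniform_limit_theorem)
    show "\<forall>\<^sub>F M in sequentially. continuous_on {0..T} (\<lambda>t. projP M e (v t))"
      unfolding projP_def by (intro always_eventually allI continuous_intros coeff)
    show "uniform_limit {0..T} (\<lambda>M t. projP M e (v t)) v sequentially"
    proof (rule uniform_limitI)
      fix r :: real assume "0 < r"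
      have "(\<lambda>M. norm (projQ M e x) + K0 / lam M) \<longlonglongrightarrow> 0 + 0"
        by (intro tendsto_add projQ_tendsto_0 divide_lam_tendsto_0)
      then have "\<forall>\<^sub>F M in sequentially. norm (projQ M e x) + K0 / lam M < r"
        using \<open>0 < r\<close> by (intro order_tendstoD(2)) simp_all
      then show "\<forall>\<^sub>F M in sequentially. \<forall>t\<in>{0..T}. dist (projP M e (v t)) (v t) < r"
      proof (eventually_elim, intro ballI)
        fix M t assume *: "norm (projQ M e x) + K0 / lam M < r" and t: "t \<in> {0..T}"
        have "norm (projQ M e (v t)) \<le> norm (projQ M e (v 0)) + K0 / lam M"
          using t by (intro duhamel_tail_bound[OF _ cw[OF t] D[OF t]]) simp
        then show "dist (projP M e (v t)) (v t) < r"
          using * by (simp add: v0 dist_norm projQ_def norm_minus_commute)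
      qed
    qed
  qed simp
  then show ?thesis using v0 D by blast
qed

text \<open>Picard iteration from the constant function \<open>x\<close>, on the whole interval at
  once.\<close>

lemma mild_solution_exists:
  assumes "0 \<le> T"
  shows "\<exists>u. mild_solution lam e F {0..T} u \<and> u 0 = x"
proof -
  have "\<forall>w. \<exists>v. continuous_on {0..T} w \<longrightarrow> continuous_on {0..T} v \<and> v 0 = x \<and> (\<forall>t\<in>{0..T}. duhamel w v 0 t)"
    using picard_step by blast
  then obtain picard where picard: "\<And>w. continuous_on {0..T} w \<Longrightarrow>
      continuous_on {0..T} (picard w) \<and> picard w 0 = x \<and> (\<forall>t\<in>{0..T}. duhamel w (picard w) 0 t)"
    by metis
  define U where "U m = (picard ^^ m) (\<lambda>_. x)" for m
  have U_Suc: "U (Suc m) = picard (U m)" for m by (simp add: U_def)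
  have U_cont: "continuous_on {0..T} (U m)" for m
    by (induction m) (simp_all add: U_Suc picard U_def[of 0])
  have U_0: "U m 0 = x" for m
    by (cases m) (simp_all add: U_Suc picard U_cont U_def[of 0])
  have U_D: "duhamel (U m) (U (Suc m)) 0 t" if "t \<in> {0..T}" for m t
    using picard[OF U_cont] that by (simp add: U_Suc)
  have "compact ((\<lambda>t. norm (U 1 t - U 0 t)) ` {0..T})"
    by (intro compact_continuous_image continuous_intros U_cont) simp
  then have "bdd_above ((\<lambda>t. norm (U 1 t - U 0 t)) ` {0..T})"
    by (intro bounded_imp_bdd_above compact_imp_bounded)
  then obtain c where "\<forall>y\<in>(\<lambda>t. norm (U 1 t - U 0 t)) ` {0..T}. y \<le> c"
    by (rule bdd_above.E) blast
  then have c: "norm (U 1 t - U 0 t) \<le> c" if "t \<in> {0..T}" for t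
    using that by blast
  have "0 \<le> c"
    using \<open>0 \<le> T\<close> by (intro order_trans[OF norm_ge_zero c[of 0]]) simp
  txt \<open>The exponential weight turns the Picard map into a contraction with factor one half.\<close>
  have step: "norm (U (Suc m) t - U m t) \<le> c * (1/2)^m * exp (2 * K1 * t)" if "t \<in> {0..T}" for m t
    using that
  proof (induction m arbitrary: t)
    case 0
    have "norm (U 1 t - U 0 t) \<le> c * 1" using c[OF 0] by simp
    also have "\<dots> \<le> c * exp (2 * K1 * t)"
      using 0 \<open>0 \<le> c\<close> K1_pos by (intro mult_left_mono) auto
    finally show ?case by simp
  next
    case (Suc m)
    let ?C = "K1 * (c * (1/2)^m)"
    have cont: "continuous_on {0..t} (U k)" for k
      using U_cont[of k] by (rule continuous_on_subset) (use Suc in auto)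
    have "norm (U (Suc (Suc m)) t - U (Suc m) t) \<le> norm (U (Suc (Suc m)) 0 - U (Suc m) 0)
        + ?C * ((exp (2 * K1 * t) - exp (2 * K1 * 0)) / (2 * K1))"
    proof (rule duhamel_diff_bound[OF _ cont cont U_D[OF Suc.prems] U_D[OF Suc.prems]])
      show "0 \<le> t" using Suc.prems by simp
      then show "((\<lambda>\<tau>. ?C * exp (2 * K1 * \<tau>)) has_integral ?C * ((exp (2 * K1 * t) - exp (2 * K1 * 0)) / (2 * K1))) {0..t}"
        using K1_pos by (intro has_integral_mult_right has_integral_exp) auto
      fix \<tau> assume "\<tau> \<in> {0..t}"
      then show "K1 * norm (U (Suc m) \<tau> - U m \<tau>) \<le> ?C * exp (2 * K1 * \<tau>)"
        using Suc.IH[of \<tau>] Suc.prems K1_pos by (simp add: mult.assoc mult_left_mono)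
    qed
    \<comment> \<open>The iterates agree at time 0, and the \<open>2 * K1\<close> from integrating
      the weight turns \<open>K1\<close> into one half.\<close>
    also have "\<dots> = c * (1/2)^Suc m * (exp (2 * K1 * t) - 1)"
      using K1_pos by (simp add: U_0 field_simps)
    also have "\<dots> \<le> c * (1/2)^Suc m * exp (2 * K1 * t)"
      using \<open>0 \<le> c\<close> by (intro mult_left_mono) auto
    finally show ?case .
  qed
  define E where "E = c * exp (2 * K1 * T)"
  have "0 \<le> E" using \<open>0 \<le> c\<close> by (simp add: E_def)
  have step': "norm (U (Suc m) t - U m t) \<le> E * (1/2)^m" if "t \<in> {0..T}" for m t
  proof -
    have "c * (1/2)^m * exp (2 * K1 * t) \<le> c * (1/2)^m * exp (2 * K1 * T)"
      using that \<open>0 \<le> c\<close> K1_pos by (intro mult_left_mono) auto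
    then show ?thesis using step[OF that, of m] by (simp add: E_def mult_ac)
  qed
  \<comment> \<open>The factor \<open>1 - (1/2)^k\<close> is the exact partial geometric sum, which
    lets the induction close.\<close>
  have tele: "norm (U (m + k) t - U m t) \<le> 2 * E * (1/2)^m * (1 - (1/2)^k)" if "t \<in> {0..T}" for m k t
  proof (induction k)
    case (Suc k)
    have "norm (U (m + Suc k) t - U m t) \<le> norm (U (Suc (m + k)) t - U (m + k) t) + norm (U (m + k) t - U m t)"
      using norm_triangle_ineq[of "U (Suc (m + k)) t - U (m + k) t" "U (m + k) t - U m t"] by simp
    also have "\<dots> \<le> E * (1/2)^(m + k) + 2 * E * (1/2)^m * (1 - (1/2)^k)"
      by (intro add_mono step' Suc.IH that)
    also have "\<dots> = 2 * E * (1/2)^m * (1 - (1/2)^Suc k)"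
      by (simp add: power_add field_simps)
    finally show ?case .
  qed simp
  have "uniformly_Cauchy_on {0..T} U"
  proof (rule uniformly_Cauchy_onI')
    fix r :: real assume "0 < r"
    have "(\<lambda>m. 2 * E * (1/2)^m) \<longlonglongrightarrow> 2 * E * 0"
      by (intro tendsto_intros LIMSEQ_realpow_zero) auto
    then have "\<forall>\<^sub>F m in sequentially. 2 * E * (1/2)^m < r"
      using \<open>0 < r\<close> by (intro order_tendstoD(2)) simp_all
    then obtain M where M: "\<And>m. m \<ge> M \<Longrightarrow> 2 * E * (1/2)^m < r"
      unfolding eventually_sequentially by blast
    have "dist (U m t) (U n t) < r" if "t \<in> {0..T}" "m \<ge> M" "n > m" for t m n
    proof -
      have "dist (U m t) (U n t) \<le> 2 * E * (1/2)^m * (1 - (1/2)^(n - m))"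
        using tele[OF that(1), of m "n - m"] that by (simp add: dist_norm norm_minus_commute)
      also have "\<dots> \<le> 2 * E * (1/2)^m"
        using \<open>0 \<le> E\<close> by (intro mult_left_le) auto
      finally show ?thesis using M[OF that(2)] by simp
    qed
    then show "\<exists>M. \<forall>x\<in>{0..T}. \<forall>m\<ge>M. \<forall>n>m. dist (U m x) (U n x) < r" by blast
  qed
  then obtain u where u: "uniform_limit {0..T} U u sequentially"
    using Cauchy_uniformly_convergent uniformly_convergent_on_def by blast
  have u_cont: "continuous_on {0..T} u"
    by (rule uniform_limit_theorem[OF _ u]) (simp_all add: U_cont)
  have lim: "(\<lambda>m. U (Suc m) t) \<longlonglongrightarrow> u t" if "t \<in> {0..T}" for t
    by (rule LIMSEQ_Suc) (rule tendsto_uniform_limitI[OF u that])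
  \<comment> \<open>Forcing by \<open>U m\<close> produces \<open>U (Suc m)\<close>; both sequences
    tend to \<open>u\<close>, so the limit is forced by itself.\<close>
  have D: "duhamel u u 0 t" if t: "t \<in> {0..T}" for t
  proof (rule duhamel_limit[where w = U and v = "\<lambda>m. U (Suc m)"])
    show "uniform_limit {0..t} U u sequentially"
      using u by (rule uniform_limit_on_subset) (use t in auto)
    show "continuous_on {0..t} (U m)" for m
      using U_cont by (rule continuous_on_subset) (use t in auto)
  qed (use t \<open>0 \<le> T\<close> in \<open>auto intro: lim U_D\<close>)
  have "mild_solution lam e F {0..T} u"
  proof (subst mild_solution_iff, force, intro conjI ballI impI u_cont)
    fix s t assume "s \<in> {0..T}" "t \<in> {0..T}" "s \<le> t"
    then show "duhamel u u s t"
      using u_cont by (intro duhamel_remainder[OF _ _ _ D D]) (auto intro: continuous_on_subset)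
  qed
  moreover have "u 0 = x"
    using lim[of 0] \<open>0 \<le> T\<close> by (simp add: U_0 LIMSEQ_const_iff)
  ultimately show ?thesis by blast
qed

lemma mild_solution_lipschitz:
  assumes "0 \<le> T" and u: "mild_solution lam e F {0..T} u" and v: "mild_solution lam e F {0..T} v"
  shows "norm (u T - v T) \<le> norm (u 0 - v 0) * exp (K1 * T)"
  using duhamel_gronwall[of 0 T u v T] mild_solution_continuous[OF u] mild_solution_continuous[OF v]
    mild_solution_duhamel[OF u] mild_solution_duhamel[OF v] \<open>0 \<le> T\<close> by simp

text \<open>Along the low modes the time-\<open>T\<close> map is the invertible linear flow plus a bounded perturbation,
  so on a large cube it satisfies the boundary conditions of the Poincare--Miranda theorem.\<close>
lemma shooting:
  assumes "0 \<le> T"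
  shows "\<exists>u. mild_solution lam e F {0..T} u \<and> projQ N e (u 0) = 0 \<and> projP N e (u T) = projP N e c"
proof -
  let ?S = "PiE UNIV (\<lambda>_. {0..1}) :: (nat \<Rightarrow> real) set"
  \<comment> \<open>The nonlinearity shifts the rescaled coefficient \<open>i\<close> by at most
    \<open>exp (lam i * T) * (K0 * T)\<close>. The surplus involving \<open>norm c\<close> fixes the
    sign relative to the target, and \<open>lam N\<close> covers all \<open>i < N\<close>.\<close>
  define L where "L = exp (lam N * T) * (K0 * T + norm c)"
  \<comment> \<open>Maps the unit cube onto the cube of half side \<open>L\<close> in the span of
    the first \<open>N\<close> eigenvectors.\<close>
  define A where "A x = (\<Sum>i<N. (L * (2 * x i - 1)) *\<^sub>R e i)" for x
  obtain U where U: "\<And>a. mild_solution lam e F {0..T} (U a)" "\<And>a. U a 0 = a"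
    using mild_solution_exists[OF assms] by metis
  have A_inner: "A x \<bullet> e i = L * (2 * x i - 1)" if "i < N" for x i
    using that by (simp add: A_def inner_sum_basis)
  have bound: "\<bar>exp (lam i * T) * (U a T \<bullet> e i) - a \<bullet> e i\<bar> \<le> exp (lam i * T) * (K0 * T)" for a i
  proof -
    have "duhamel (U a) (U a) 0 T"
      using mild_solution_duhamel[OF U(1)] assms by simp
    then show ?thesis
      using duhamel_coeff_bound[OF assms, of "U a" "U a" i] U(2)[of a] by (simp add: mult.assoc)
  qed
  have L_ge: "exp (lam i * T) * (K0 * T + norm c) \<le> L" if "i < N" for i
    using monoD[OF lam_mono, of i N] that assms K0_nonneg unfolding L_def
    by (intro mult_right_mono) (auto intro: mult_right_mono)
  have "\<exists>x\<in>?S. \<forall>i<N. (U (A x) T - c) \<bullet> e i = 0"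
  proof (rule poincare_miranda)
    fix i assume "i < N"
    have "(exp (K1 * T))-lipschitz_on UNIV (\<lambda>a. U a T)"
      using mild_solution_lipschitz[OF assms U(1) U(1)]
      by (intro lipschitz_onI) (auto simp: dist_norm U(2) mult.commute)
    then have "continuous_on UNIV (\<lambda>a. U a T)"
      by (rule lipschitz_on_continuous_on)
    moreover have "continuous_on ?S A"
      unfolding A_def
      by (intro continuous_intros continuous_on_subset[OF continuous_on_product_coordinates]) auto
    ultimately have "continuous_on ?S (\<lambda>x. U (A x) T)"
      using continuous_on_compose2 by blast
    then show "continuous_on ?S (\<lambda>x. (U (A x) T - c) \<bullet> e i)"
      by (intro continuous_intros)
  next
    fix x i assume i: "i < N" and "x i = (0::real)"
    then have "A x \<bullet> e i = - L" by (simp add: A_inner)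
    then have "exp (lam i * T) * (U (A x) T \<bullet> e i) \<le> exp (lam i * T) * (- norm c)"
      using bound[of i "A x"] L_ge[OF i] by (simp add: algebra_simps)
    then have "U (A x) T \<bullet> e i \<le> - norm c"
      by (simp only: exp_gt_zero mult_le_cancel_left_pos)
    then show "(U (A x) T - c) \<bullet> e i \<le> 0"
      using norm_coeff_le[of c i] by (simp add: inner_diff_left)
  next
    fix x i assume i: "i < N" and "x i = (1::real)"
    then have "A x \<bullet> e i = L" by (simp add: A_inner)
    then have "exp (lam i * T) * norm c \<le> exp (lam i * T) * (U (A x) T \<bullet> e i)"
      using bound[of i "A x"] L_ge[OF i] unfolding distrib_left by linarith
    then have "norm c \<le> U (A x) T \<bullet> e i"
      by (simp only: exp_gt_zero mult_le_cancel_left_pos)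
    then show "0 \<le> (U (A x) T - c) \<bullet> e i"
      using norm_coeff_le[of c i] by (simp add: inner_diff_left)
  qed
  then obtain x where x: "\<And>i. i < N \<Longrightarrow> (U (A x) T - c) \<bullet> e i = 0" by blast
  have "projP N e (U (A x) T) = projP N e c"
    using x by (intro coeffs_eqI) (simp add: projP_inner inner_diff_left)
  moreover have "projQ N e (U (A x) 0) = 0"
    by (intro coeffs_eqI) (simp add: projQ_inner U(2) A_def inner_sum_basis)
  ultimately show ?thesis using U(1) by blast
qed

section \<open>Comparison of the two limit sets\<close>

lemma M_pinf_subset_M_ninf: "M_pinf lam e F N \<subseteq> M_ninf lam e F N"
proof
  fix x assume "x \<in> M_pinf lam e F N"
  then obtain n y where n: "strict_mono n" and "\<forall>k. y k \<in> Mt lam e F N (real (n k))"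
    and y: "y \<longlonglongrightarrow> x"
    unfolding M_pinf_def by blast
  then have "\<forall>k. \<exists>u. mild_solution lam e F {0..real (n k)} u \<and> projQ N e (u 0) = 0 \<and> y k = u (real (n k))"
    unfolding Mt_def by blast
  from choice[OF this]
  obtain u where U: "\<forall>k. mild_solution lam e F {0..real (n k)} (u k) \<and> projQ N e (u k 0) = 0 \<and> y k = u k (real (n k))" ..
  note u = U[rule_format, THEN conjunct1] and u0 = U[rule_format, THEN conjunct2, THEN conjunct1]
    and uy = U[rule_format, THEN conjunct2, THEN conjunct2]
  \<comment> \<open>Shifted so that all solutions end at time 0, with starting times receding to
    minus infinity.\<close>
  define v where "v k t = u k (t + real (n k))" for k t
  have v_y: "v k 0 = y k" for k by (simp add: v_def uy)
  have v_cont: "continuous_on {- real (n k)..0} (v k)" for k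
    unfolding v_def using mild_solution_continuous[OF u[of k]]
    by (auto intro!: continuous_on_compose2[of "{0..real (n k)}" "u k" _ "\<lambda>t. t + real (n k)"]
        continuous_on_add continuous_on_id continuous_on_const)
  have v_cont': "continuous_on {s..t} (v k)" if "- real (n k) \<le> s" "t \<le> 0" for s t k
    using v_cont by (rule continuous_on_subset) (use that in auto)
  have v_D: "duhamel (v k) (v k) s t" if "- real (n k) \<le> s" "s \<le> t" "t \<le> 0" for k s t
    unfolding v_def by (rule duhamel_shift) (rule mild_solution_duhamel[OF u[of k]], use that in auto)
  \<comment> \<open>The start at \<open>- real (n k)\<close> has no modes from \<open>N\<close> on,
    so only the forcing term of the tail bound remains.\<close>
  have v_tail: "norm (projQ M e (v k t)) \<le> K0 / lam M" if "- real (n k) \<le> t" "t \<le> 0" "M \<ge> N" for k t M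
  proof -
    have "norm (projQ M e (v k t)) \<le> norm (projQ M e (v k (- real (n k)))) + K0 / lam M"
      using that by (intro duhamel_tail_bound[where w = "v k"] v_cont' v_D) auto
    then show ?thesis
      using projQ_eq_0_mono[OF u0 \<open>M \<ge> N\<close>] by (simp add: v_def)
  qed
  obtain Y where Y: "\<And>k. norm (y k) \<le> Y"
    using convergent_imp_bounded[OF y] by (auto simp: bounded_iff)
  \<comment> \<open>Read backwards in time: the coefficient at 0 is bounded by \<open>Y\<close>, and
    undoing the decay costs \<open>exp (lam j * real m)\<close>.\<close>
  have v_coeff: "\<bar>v k (- real m) \<bullet> e j\<bar> \<le> exp (lam j * real m) * (Y + K0 * real m)" if "m \<le> n k" for k m j
  proof -
    let ?E = "exp (lam j * real m)"
    have "\<bar>v k 0 \<bullet> e j - exp (- (lam j * real m)) * (v k (- real m) \<bullet> e j)\<bar> \<le> K0 * real m"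
      using duhamel_coeff_bound[of "- real m" 0 "v k" "v k" j] v_D[of k "- real m" 0] that by simp
    moreover have "\<bar>v k 0 \<bullet> e j\<bar> \<le> Y"
      using norm_coeff_le[of "v k 0" j] Y[of k] by (simp add: v_y)
    ultimately have "\<bar>exp (- (lam j * real m)) * (v k (- real m) \<bullet> e j)\<bar> \<le> Y + K0 * real m"
      by linarith
    then have "?E * \<bar>exp (- (lam j * real m)) * (v k (- real m) \<bullet> e j)\<bar> \<le> ?E * (Y + K0 * real m)"
      by (rule mult_left_mono) simp
    moreover have "?E * \<bar>exp (- (lam j * real m)) * (v k (- real m) \<bullet> e j)\<bar> = \<bar>v k (- real m) \<bullet> e j\<bar>"
      by (simp add: abs_mult exp_minus)
    ultimately show ?thesis by simp
  qed
  txt \<open>Padding with zero the finitely many \<open>k\<close> for which \<open>v k\<close> is not yet defined at time \<open>- m\<close>.\<close>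
  define V where "V m k = (if m \<le> n k then v k (- real m) else 0)" for m k
  \<comment> \<open>The refinement property behind the diagonal construction: any subsequence can be
    thinned to converge at time \<open>- m\<close>.\<close>
  have V_sub: "\<exists>r. strict_mono r \<and> convergent (V m \<circ> (s \<circ> r))" for m and s :: "nat \<Rightarrow> nat"
  proof -
    have "0 \<le> Y" using order_trans[OF norm_ge_zero Y] .
    have "\<exists>l r. strict_mono r \<and> ((\<lambda>k. V m (s k)) \<circ> r) \<longlonglongrightarrow> l"
    proof (rule convergent_subseq_of_tails)
      show "\<bar>V m (s k) \<bullet> e j\<bar> \<le> exp (lam j * real m) * (Y + K0 * real m)" for k j
        using v_coeff[of m "s k" j] \<open>0 \<le> Y\<close> K0_nonneg by (auto simp: V_def)
      show "norm (projQ M e (V m (s k))) \<le> K0 / lam M" if "M \<ge> N" for k M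
      proof (cases "m \<le> n (s k)")
        case True
        then show ?thesis using v_tail[of "s k" "- real m" M] that by (simp add: V_def)
      next
        case False
        then show ?thesis
          using K0_nonneg lam_gt_0[of M] by (simp add: V_def projQ_def projP_def)
      qed
    qed (rule divide_lam_tendsto_0)
    then show ?thesis by (auto simp: convergent_def o_def)
  qed
  interpret sub: subseqs "\<lambda>m s. convergent (V m \<circ> s)"
    by unfold_locales (rule V_sub)
  define d where "d = sub.diagseq"
  have d: "strict_mono d" by (simp add: d_def sub.subseq_diagseq)
  have V_conv: "convergent (\<lambda>k. V m (d k))" for m
  proof -
    \<comment> \<open>The diagonal sequence is a subsequence of stage \<open>m\<close> only after
      its first \<open>Suc m\<close> terms, which do not affect convergence.\<close>
    have "convergent (V m \<circ> (d \<circ> (+) (Suc m)))"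
      unfolding d_def
    proof (rule sub.diagseq_holds)
      fix r s :: "nat \<Rightarrow> nat" and i assume r: "strict_mono r" and c: "convergent (V i \<circ> s)"
      show "convergent (V i \<circ> (s \<circ> r))"
        using convergent_subseq_convergent[OF c r] by (simp add: o_assoc)
    qed
    then have "convergent (\<lambda>k. V m (d (k + Suc m)))"
      by (simp add: o_def add.commute)
    then show ?thesis
      using convergent_ignore_initial_segment[of "\<lambda>k. V m (d k)" "Suc m"] by simp
  qed
  define W where "W k = v (d k)" for k
  \<comment> \<open>Hence \<open>W k\<close> is a genuine solution on \<open>{- real m..0}\<close>
    as soon as \<open>k\<close> is at least \<open>m\<close>.\<close>
  have n_ge: "m \<le> n (d k)" if "m \<le> k" for m k
    using seq_suble[OF d, of k] seq_suble[OF n, of "d k"] that by linarith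
  define U where "U t = lim (\<lambda>k. W k t)" for t
  \<comment> \<open>Convergence at the single time \<open>- m\<close> spreads over the interval by
    continuous dependence, at the cost of the factor \<open>exp (K1 * real m)\<close>.\<close>
  have U_lim: "uniform_limit {- real m..0} W U sequentially" for m
    unfolding U_def uniformly_convergent_uniform_limit_iff[symmetric]
  proof (rule Cauchy_uniformly_convergent, rule uniformly_Cauchy_onI')
    fix r :: real assume "0 < r"
    let ?E = "exp (K1 * real m)"
    have "0 < r / ?E" using \<open>0 < r\<close> by simp
    with convergent_Cauchy[OF V_conv[of m]]
    obtain k1 where k1: "\<And>k l. k \<ge> k1 \<Longrightarrow> l \<ge> k1 \<Longrightarrow> dist (V m (d k)) (V m (d l)) < r / ?E"
      by (meson metric_CauchyD)
    have "dist (W k t) (W l t) < r" if t: "t \<in> {- real m..0}" and k: "k \<ge> max m k1" and l: "l > k" for t k l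
    proof -
      have nk: "m \<le> n (d k)" and nl: "m \<le> n (d l)" using n_ge k l by auto
      have "norm (W k t - W l t) \<le> norm (W k (- real m) - W l (- real m)) * exp (K1 * (t - - real m))"
        using nk nl unfolding W_def
        by (intro duhamel_gronwall[of _ 0] v_cont' v_D t) auto
      also have "\<dots> \<le> norm (W k (- real m) - W l (- real m)) * ?E"
        using t K1_pos by (intro mult_left_mono) auto
      also have "\<dots> < (r / ?E) * ?E"
        using k1[of k l] k l nk nl
        by (intro mult_strict_right_mono) (auto simp: V_def W_def dist_norm)
      finally show ?thesis by (simp add: dist_norm)
    qed
    then show "\<exists>M. \<forall>t\<in>{- real m..0}. \<forall>k\<ge>M. \<forall>l>k. dist (W k t) (W l t) < r"
      by blast
  qed
  have W_U: "(\<lambda>k. W k t) \<longlonglongrightarrow> U t" if "t \<le> 0" for t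
  proof -
    obtain m where "- t \<le> real m" using real_arch_simple by blast
    then show ?thesis
      using that by (intro tendsto_uniform_limitI[OF U_lim[of m]]) auto
  qed
  have U_cont: "continuous_on {- real m..0} U" for m
  proof (rule uniform_limit_theorem[OF _ U_lim])
    have "continuous_on {- real m..0} (W k)" if "m \<le> k" for k
      unfolding W_def using n_ge[OF that] by (intro v_cont') auto
    then show "\<forall>\<^sub>F k in sequentially. continuous_on {- real m..0} (W k)"
      unfolding eventually_sequentially by blast
  qed simp
  have U_D: "duhamel U U s t" if st: "s \<le> t" "t \<le> 0" for s t
  proof -
    obtain m where m: "- s \<le> real m" using real_arch_simple by blast
    \<comment> \<open>Advancing the index by \<open>m\<close> discards the solutions that start
      after \<open>s\<close>.\<close>
    have n_m: "- real (n (d (k + m))) \<le> s" for k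
      using n_ge[of m "k + m"] m by linarith
    have "uniform_limit {- real m..0} (\<lambda>k. W (k + m)) U sequentially"
      using filterlim_compose[OF U_lim filterlim_add_const_nat_at_top] .
    then have lim: "uniform_limit {s..t} (\<lambda>k. W (k + m)) U sequentially"
      by (rule uniform_limit_on_subset) (use m st in auto)
    show ?thesis
    proof (rule duhamel_limit[OF lim])
      show "(\<lambda>k. W (k + m) s) \<longlonglongrightarrow> U s" "(\<lambda>k. W (k + m) t) \<longlonglongrightarrow> U t"
        using st by (auto intro!: LIMSEQ_ignore_initial_segment W_U)
      show "continuous_on {s..t} (W (k + m))" "duhamel (W (k + m)) (W (k + m)) s t" for k
        unfolding W_def using st n_m[of k] by (auto intro: v_cont' v_D)
    qed
  qed
  have "continuous_on {..0} U"
    unfolding continuous_on_def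
  proof
    fix t :: real assume t: "t \<in> {..0}"
    \<comment> \<open>The strict inequality makes \<open>{- real m..0}\<close> a neighbourhood of
      \<open>t\<close> within the half line.\<close>
    obtain m where m: "- t < real m" using reals_Archimedean2 by blast
    have "(U \<longlongrightarrow> U t) (at t within {- real m..0})"
      using U_cont[of m] t m by (auto simp: continuous_on_def)
    moreover have "at t within {- real m..0} = at t within {..0}"
      by (rule at_within_nhd[of t "{- real m<..}"]) (use m in auto)
    ultimately show "(U \<longlongrightarrow> U t) (at t within {..0})" by simp
  qed
  then have "mild_solution lam e F {..0} U"
    by (subst mild_solution_iff) (auto intro: U_D)
  moreover have "U 0 = x"
  proof -
    have "(\<lambda>k. W k 0) \<longlonglongrightarrow> x"
      using LIMSEQ_subseq_LIMSEQ[OF y d] by (simp add: W_def v_y o_def)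
    then show ?thesis using W_U[of 0] LIMSEQ_unique by simp
  qed
  moreover have "bounded ((\<lambda>t. projQ N e (U t)) ` {..0})"
  proof (rule boundedI)
    fix z assume "z \<in> (\<lambda>t. projQ N e (U t)) ` {..0}"
    then obtain t where t: "t \<le> 0" and z: "z = projQ N e (U t)" by auto
    obtain m where m: "- t \<le> real m" using real_arch_simple by blast
    have "(\<lambda>k. norm (projQ N e (W k t))) \<longlonglongrightarrow> norm (projQ N e (U t))"
      by (intro tendsto_norm bounded_linear.tendsto[OF bounded_linear_projQ] W_U t)
    moreover have "norm (projQ N e (W k t)) \<le> K0 / lam N" if "k \<ge> m" for k
      unfolding W_def using n_ge[OF that] m t by (intro v_tail) auto
    ultimately show "norm z \<le> K0 / lam N"
      unfolding z by (intro LIMSEQ_le_const2) blast+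
  qed
  ultimately show "x \<in> M_ninf lam e F N"
    unfolding M_ninf_def by blast
qed

lemma M_pinf_over:
  "\<exists>l \<in> M_pinf lam e F N. projP N e l = projP N e x"
proof -
  have "\<forall>k. \<exists>u. mild_solution lam e F {0..real (Suc k)} u \<and> projQ N e (u 0) = 0 \<and>
      projP N e (u (real (Suc k))) = projP N e x"
    by (intro allI shooting) simp
  from choice[OF this]
  obtain u where U: "\<forall>k. mild_solution lam e F {0..real (Suc k)} (u k) \<and> projQ N e (u k 0) = 0 \<and>
      projP N e (u k (real (Suc k))) = projP N e x" ..
  note u = U[rule_format, THEN conjunct1] and u0 = U[rule_format, THEN conjunct2, THEN conjunct1]
    and uP = U[rule_format, THEN conjunct2, THEN conjunct2]
  define y where "y k = u k (real (Suc k))" for k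
  have tail: "norm (projQ M e (y k)) \<le> K0 / lam M" if "M \<ge> N" for k M
  proof -
    have "norm (projQ M e (u k (real (Suc k)))) \<le> norm (projQ M e (u k 0)) + K0 / lam M"
      using mild_solution_continuous[OF u] mild_solution_duhamel[OF u]
      by (intro duhamel_tail_bound[where w = "u k"]) auto
    then show ?thesis
      using projQ_eq_0_mono[OF u0 that] by (simp add: y_def)
  qed
  have bound: "\<bar>y k \<bullet> e j\<bar> \<le> norm x + K0 / lam N" for k j
  proof -
    have "y k = projP N e x + projQ N e (y k)"
      using uP[of k] by (simp add: projQ_def y_def)
    then have "norm (y k) \<le> norm (projP N e x) + norm (projQ N e (y k))"
      by (metis norm_triangle_ineq)
    then show ?thesis
      using norm_coeff_le[of "y k" j] norm_projP_le[of N x] tail[of N k] by simp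
  qed
  have "\<exists>l r. strict_mono r \<and> (y \<circ> r) \<longlonglongrightarrow> l"
    by (rule convergent_subseq_of_tails[OF bound _ divide_lam_tendsto_0]) (rule tail)
  then obtain l r where r: "strict_mono r" and l: "(y \<circ> r) \<longlonglongrightarrow> l"
    by blast
  have "l \<in> M_pinf lam e F N"
    unfolding M_pinf_def mem_Collect_eq
  proof (intro exI conjI allI)
    show "strict_mono (\<lambda>k. Suc (r k))" using r by (simp add: strict_mono_def)
    show "(y \<circ> r) k \<in> Mt lam e F N (real (Suc (r k)))" for k
      using u u0 unfolding Mt_def y_def o_def by blast
    show "(y \<circ> r) \<longlonglongrightarrow> l" by (rule l)
  qed simp
  moreover have "projP N e l = projP N e x"
  proof -
    have "(\<lambda>k. projP N e (y (r k))) \<longlonglongrightarrow> projP N e l"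
      using bounded_linear.tendsto[OF bounded_linear_projP l, of N] by (simp add: o_def)
    then show ?thesis
      unfolding y_def uP by (simp add: LIMSEQ_const_iff)
  qed
  ultimately show ?thesis by blast
qed

end

theorem theorem4p3:
  fixes e :: "nat \<Rightarrow> 'a::{real_inner,complete_space}"
    and lam :: "nat \<Rightarrow> real" and F :: "'a \<Rightarrow> 'a"
    and N :: nat and K0 K1 R :: real
  assumes orthonormal: "\<And>i j. e i \<bullet> e j = (if i = j then 1 else 0)"
    and basis: "closure (span (range e)) = UNIV"
    and lam_pos: "0 < lam 0" and lam_01: "lam 0 < lam 1" and lam_mono: "mono lam"
    and lam_inf: "filterlim lam at_top sequentially"
    and N_pos: "1 \<le> N" and gap: "lam (N - 1) < lam N"
    and K0: "0 < K0" and K1: "0 < K1" and K1_gap: "K1 < lam N" and R: "0 < R"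
    and F_bdd: "\<And>u. norm (F u) \<le> K0"
    and F_lip: "\<And>u v. norm (F u - F v) \<le> K1 * norm (u - v)"
    and F_supp: "\<And>u. norm u \<ge> R \<Longrightarrow> F u = 0"
    and single: "\<And>p0. p0 \<in> range (projP N e) \<Longrightarrow> \<exists>!q0. q0 \<in> Phi lam e F N p0"
  shows "M_pinf lam e F N = M_ninf lam e F N"
proof
  interpret semilinear e lam F K0 K1
    using orthonormal basis lam_pos lam_mono lam_inf K1 F_bdd F_lip by unfold_locales
  show "M_pinf lam e F N \<subseteq> M_ninf lam e F N"
    by (rule M_pinf_subset_M_ninf)
  show "M_ninf lam e F N \<subseteq> M_pinf lam e F N"
  proof
    fix x assume x: "x \<in> M_ninf lam e F N"
    obtain l where l: "l \<in> M_pinf lam e F N" and P: "projP N e l = projP N e x"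
      using M_pinf_over by blast
    have "projQ N e z \<in> Phi lam e F N (projP N e z)" if "z \<in> M_ninf lam e F N" for z
      using that by (simp add: Phi_def projQ_def)
    then have "projQ N e x \<in> Phi lam e F N (projP N e x)" "projQ N e l \<in> Phi lam e F N (projP N e x)"
      using x l P M_pinf_subset_M_ninf by (metis, metis subsetD)
    then have "projQ N e x = projQ N e l"
      using single[of "projP N e x"] by blast
    then have "x = l" using P by (simp add: projQ_def)
    then show "x \<in> M_pinf lam e F N" using l by simp
  qed
qed

end
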